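(* Let $N\ge 2$, $1<p<\frac{N+3}{N-1}$, $1<q<\frac{N+2}{N}$ and let $\Omega\subset\mathbb{R}^N$ be a domain. Then there exist $a>0$ and $c_{N,p,q}>0$ (not depending on $M$) such that for any $M>0$, any positive solution $u$ of $$-\Delta u=|u|^{p-1}u+M|\nabla u|^q\quad\text{in }\Omega$$ satisfies $$|\nabla (u^{a})(x)|\le c_{N,p,q}\big(\mathrm{dist}(x,\partial\Omega)\big)^{-\frac{2a}{p-1}-1}\qquad\text{for all }x\in\Omega .$$ Hence, for any $M>0$, there exists no nontrivial nonnegative solution of the equation in $\mathbb{R}^N$.
   Context: Solutions are classical ($C^2$). A domain is a connected open set. The constant $c_{N,p,q}$ depends only on $N,p,q$. In the estimate $\partial\Omega\ne\emptyset$; the case of the whole space is the last assertion. *)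

theory Defs
  imports "HOL-Analysis.Analysis"
begin

definition partial_derivative :: "'n::finite \<Rightarrow> (real^'n \<Rightarrow> real) \<Rightarrow> real^'n \<Rightarrow> real" where
  "partial_derivative i f x = frechet_derivative f (at x) (axis i 1)"

definition gradient :: "(real^'n::finite \<Rightarrow> real) \<Rightarrow> real^'n \<Rightarrow> real^'n" where
  "gradient f x = (\<chi> i. partial_derivative i f x)"

definition laplacian :: "(real^'n::finite \<Rightarrow> real) \<Rightarrow> real^'n \<Rightarrow> real" where
  "laplacian f x = (\<Sum>i\<in>UNIV. partial_derivative i (partial_derivative i f) x)"

text \<open>The next two predicates are meant for open sets only: there, differentiability within
  the set is differentiability at each of its points, and the values of the function off the
  set are irrelevant.\<close>

definition C1_on :: "(real^'n::finite) set \<Rightarrow> (real^'n \<Rightarrow> real) \<Rightarrow> bool" where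
  "C1_on S f \<longleftrightarrow> f differentiable_on S \<and> (\<forall>i. continuous_on S (partial_derivative i f))"

definition C2_on :: "(real^'n::finite) set \<Rightarrow> (real^'n \<Rightarrow> real) \<Rightarrow> bool" where
  "C2_on S f \<longleftrightarrow> C1_on S f \<and> (\<forall>i. C1_on S (partial_derivative i f))"

definition is_domain :: "(real^'n::finite) set \<Rightarrow> bool" where
  "is_domain \<Omega> \<longleftrightarrow> open \<Omega> \<and> connected \<Omega>"

definition is_solution ::
  "real \<Rightarrow> real \<Rightarrow> real \<Rightarrow> (real^'n::finite) set \<Rightarrow> (real^'n \<Rightarrow> real) \<Rightarrow> bool" where
  "is_solution p q M \<Omega> u \<longleftrightarrow> C2_on \<Omega> u \<and>
     (\<forall>x\<in>\<Omega>. - laplacian u x =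
        \<bar>u x\<bar> powr (p - 1) * u x + M * norm (gradient u x) powr q)"

end

theory Submission
  imports Defs
begin

text \<open>Bernstein's method for \<open>l = ln u\<close>. With \<open>s = \<bar>\<nabla>l\<bar>\<^sup>2\<close>, \<open>A = u\<^bsup>p-1\<^esup>\<close> and \<open>B = M u\<^bsup>q-1\<^esup> s\<^bsup>q/2\<^esup>\<close> the equation
  reads \<open>\<Delta>l = - (s + A + B)\<close>. At a maximum point of \<open>s u\<^bsup>\<sigma>\<^esup> (R\<^sup>2 - \<bar>x - x\<^sub>0\<bar>\<^sup>2)\<^bsup>m\<^esup>\<close>, with
  \<open>m = 2 + 2\<sigma>/(p-1)\<close>, the Bochner formula and the inequality
  \<open>\<bar>D\<^sup>2l + k \<nabla>l \<otimes> \<nabla>l\<bar>\<^sup>2 \<ge> (\<Delta>l + k s)\<^sup>2 / N\<close> bound a quadratic form in \<open>(s, A, B)\<close> by terms coming from the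
  cutoff. For \<open>k = - 2/(N-1)\<close> and small \<open>\<sigma> > 0\<close> the form is coercive on the positive octant, so \<open>s\<close> and \<open>A\<close>
  are at most a multiple of \<open>R\<^sup>2 / (R\<^sup>2 - \<bar>x - x\<^sub>0\<bar>\<^sup>2)\<^sup>2\<close> there, with a constant independent of \<open>M\<close>; this
  gives the estimate for \<open>a = \<sigma>/2\<close>. In the whole space a nontrivial nonnegative solution is positive by the
  strong maximum principle, and letting \<open>R \<rightarrow> \<infinity>\<close> shows that it is constant, which the equation excludes.\<close>

subsection \<open>Partial derivatives along the coordinate axes\<close>

text \<open>Only the restriction to a coordinate line is differentiated, so sum, product, quotient
  and chain rules transfer directly from one-variable calculus, with the value of the derivative
  kept explicit.\<close>

definition has_pd :: "(real^'n::finite \<Rightarrow> real) \<Rightarrow> 'n \<Rightarrow> real \<Rightarrow> real^'n \<Rightarrow> bool" where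
  "has_pd f i D x \<longleftrightarrow> ((\<lambda>t. f (x + t *\<^sub>R axis i 1)) has_real_derivative D) (at 0)"

lemma has_pd_partial_derivative:
  assumes "f differentiable (at x)"
  shows "has_pd f i (partial_derivative i f x) x"
proof -
  have "(f has_derivative frechet_derivative f (at x)) (at x)"
    using assms by (simp add: frechet_derivative_works)
  then have "((\<lambda>t. f (x + t *\<^sub>R axis i 1)) has_derivative
      (\<lambda>t. frechet_derivative f (at x) (t *\<^sub>R axis i 1))) (at 0)"
    by (intro has_derivative_compose[of "\<lambda>t. x + t *\<^sub>R axis i 1" "\<lambda>t. t *\<^sub>R axis i 1" 0 UNIV f])
       (auto intro!: derivative_eq_intros)
  moreover have "linear (frechet_derivative f (at x))"
    using assms by (simp add: linear_frechet_derivative)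
  ultimately have "((\<lambda>t. f (x + t *\<^sub>R axis i 1)) has_derivative
      (\<lambda>t. partial_derivative i f x * t)) (at 0)"
    by (simp add: linear_cmul partial_derivative_def mult.commute)
  then show ?thesis
    unfolding has_pd_def has_field_derivative_def .
qed

lemma has_pd_shift:
  assumes "has_pd f i D (x + t *\<^sub>R axis i 1)"
  shows "((\<lambda>r. f (x + r *\<^sub>R axis i 1)) has_real_derivative D) (at t)"
proof -
  have "((\<lambda>r. f (x + (r + t) *\<^sub>R axis i 1)) has_real_derivative D) (at 0)"
    using assms by (simp add: has_pd_def algebra_simps)
  then show ?thesis
    using DERIV_shift[of "\<lambda>r. f (x + r *\<^sub>R axis i 1)" D 0 t] by simp
qed

lemma has_pd_translate:
  assumes "has_pd f i D (x + v)"
  shows "has_pd (\<lambda>y. f (y + v)) i D x"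
  using assms by (simp add: has_pd_def algebra_simps)

lemma has_pd_const: "has_pd (\<lambda>y. c) i 0 x"
  by (simp add: has_pd_def)

lemma has_pd_sum:
  assumes "\<And>j. j \<in> J \<Longrightarrow> has_pd (f j) i (D j) x"
  shows "has_pd (\<lambda>y. \<Sum>j\<in>J. f j y) i (\<Sum>j\<in>J. D j) x"
  using assms unfolding has_pd_def by (intro DERIV_sum) auto

lemma has_pd_mult:
  assumes "has_pd f i D x" "has_pd g i E x"
  shows "has_pd (\<lambda>y. f y * g y) i (D * g x + E * f x) x"
  using DERIV_mult[OF assms[unfolded has_pd_def]] unfolding has_pd_def by simp

lemma has_pd_add:
  assumes "has_pd f i D x" "has_pd g i E x"
  shows "has_pd (\<lambda>y. f y + g y) i (D + E) x"
  using DERIV_add[OF assms[unfolded has_pd_def]] unfolding has_pd_def by simp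

lemma has_pd_diff:
  assumes "has_pd f i D x" "has_pd g i E x"
  shows "has_pd (\<lambda>y. f y - g y) i (D - E) x"
  using DERIV_diff[OF assms[unfolded has_pd_def]] unfolding has_pd_def by simp

lemma has_pd_cmult:
  assumes "has_pd f i D x"
  shows "has_pd (\<lambda>y. c * f y) i (c * D) x"
  using DERIV_cmult[OF assms[unfolded has_pd_def]] unfolding has_pd_def by simp

lemma has_pd_chain:
  assumes "has_pd f i D x" "(\<phi> has_real_derivative E) (at (f x))"
  shows "has_pd (\<lambda>y. \<phi> (f y)) i (E * D) x"
  using assms DERIV_chain2[of \<phi> E "\<lambda>t. f (x + t *\<^sub>R axis i 1)" 0 D UNIV]
  unfolding has_pd_def by simp

lemma has_pd_divide:
  assumes "has_pd f i D x" "has_pd g i E x" "g x \<noteq> 0"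
  shows "has_pd (\<lambda>y. f y / g y) i ((D * g x - f x * E) / (g x * g x)) x"
  using DERIV_divide[OF assms(1,2)[unfolded has_pd_def]] assms(3) unfolding has_pd_def by simp

lemma has_pd_coord: "has_pd (\<lambda>y. y $ j - z $ j) i (if i = j then 1 else 0) x"
  unfolding has_pd_def by (auto intro!: derivative_eq_intros simp: axis_def)

lemma has_pd_dist_sq: "has_pd (\<lambda>y. (norm (y - z))\<^sup>2) i (2 * (x $ i - z $ i)) x"
proof -
  have "(norm (x + t *\<^sub>R axis i 1 - z))\<^sup>2 = (norm (x - z))\<^sup>2 + 2 * t * (x $ i - z $ i) + t\<^sup>2" for t
  proof -
    have "x + t *\<^sub>R axis i 1 - z = (x - z) + t *\<^sub>R axis i 1" by simp
    then show ?thesis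
      unfolding power2_norm_eq_inner
      by (simp add: inner_add_left inner_add_right inner_diff_left inner_diff_right inner_axis inner_axis'
          inner_axis_axis power2_eq_square algebra_simps)
  qed
  then show ?thesis
    unfolding has_pd_def by (auto intro!: derivative_eq_intros)
qed

text \<open>If \<open>D\<close> were positive, \<open>f'\<close> would be positive just to the right
  of its zero \<open>x\<close>, and the mean value theorem would make \<open>f\<close> exceed its
  maximum. Differentiability of \<open>f'\<close> is assumed at \<open>x\<close> alone.\<close>

lemma second_derivative_nonpos_at_max:
  fixes f :: "real \<Rightarrow> real"
  assumes "open S" "x \<in> S" "\<And>t. t \<in> S \<Longrightarrow> (f has_real_derivative f' t) (at t)"
    and "(f' has_real_derivative D) (at x)" "f' x = 0" and "\<And>t. t \<in> S \<Longrightarrow> f t \<le> f x"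
  shows "D \<le> 0"
proof (rule ccontr)
  assume "\<not> D \<le> 0"
  then obtain e where e: "e > 0" "\<And>h. 0 < h \<Longrightarrow> h < e \<Longrightarrow> f' (x + h) > 0"
    using has_real_derivative_pos_inc_right[of f' D x UNIV] assms(4,5) by auto
  obtain d where d: "d > 0" "ball x d \<subseteq> S" using assms(1,2) openE by blast
  define h where "h = min d e / 2"
  have h: "0 < h" "h < d" "h < e" using d e by (auto simp: h_def)
  have "\<exists>z>x. z < x + h \<and> f (x + h) - f x = (x + h - x) * f' z"
    using h d by (intro MVT2 assms(3)) (auto simp: subset_iff dist_real_def)
  then obtain z where z: "x < z" "z < x + h" "f (x + h) - f x = h * f' z" by auto
  have "f' z > 0" using e(2)[of "z - x"] z h by auto
  then have "f (x + h) > f x" using z h by (smt (verit) mult_pos_pos)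
  moreover have "x + h \<in> S" using d h by (auto simp: subset_iff dist_real_def)
  ultimately show False using assms(6) by fastforce
qed

lemma has_pd_zero_at_max:
  assumes "open U" "x \<in> U" "has_pd f i D x" "\<And>y. y \<in> U \<Longrightarrow> f y \<le> f x"
  shows "D = 0"
proof -
  have "open ((\<lambda>t. x + t *\<^sub>R axis i (1::real)) -` U)"
    by (intro open_vimage continuous_intros assms)
  moreover have "0 \<in> (\<lambda>t. x + t *\<^sub>R axis i (1::real)) -` U" using assms by simp
  ultimately obtain d where d: "d > 0" "ball 0 d \<subseteq> (\<lambda>t. x + t *\<^sub>R axis i (1::real)) -` U"
    using openE by blast
  show ?thesis
    using d assms(4)
    by (intro DERIV_local_max[OF assms(3)[unfolded has_pd_def] d(1)]) (auto simp: subset_iff)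
qed

lemma second_pd_nonpos_at_max:
  assumes "open U" "x \<in> U" "\<And>y. y \<in> U \<Longrightarrow> has_pd f i (f' y) y" "has_pd f' i D x"
    and "\<And>y. y \<in> U \<Longrightarrow> f y \<le> f x"
  shows "D \<le> 0"
proof (rule second_derivative_nonpos_at_max)
  let ?S = "(\<lambda>t. x + t *\<^sub>R axis i (1::real)) -` U"
  show "open ?S" by (intro open_vimage continuous_intros assms)
  show "0 \<in> ?S" using assms by simp
  show "((\<lambda>t. f (x + t *\<^sub>R axis i 1)) has_real_derivative f' (x + t *\<^sub>R axis i 1)) (at t)"
    if "t \<in> ?S" for t using that assms(3) by (intro has_pd_shift) auto
  show "((\<lambda>t. f' (x + t *\<^sub>R axis i 1)) has_real_derivative D) (at 0)"
    using assms(4) by (simp add: has_pd_def)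
  show "f' (x + 0 *\<^sub>R axis i 1) = 0"
    using has_pd_zero_at_max[OF assms(1,2) assms(3)[OF assms(2)] assms(5)] by simp
  show "f (x + t *\<^sub>R axis i 1) \<le> f (x + 0 *\<^sub>R axis i 1)" if "t \<in> ?S" for t
    using assms(5) that by auto
qed

subsection \<open>Bochner inequality by difference quotients\<close>

definition diff_quot :: "real \<Rightarrow> 'n \<Rightarrow> (real^'n::finite \<Rightarrow> real) \<Rightarrow> real^'n \<Rightarrow> real" where
  "diff_quot h i f x = (f (x + h *\<^sub>R axis i 1) - f x) / h"

text \<open>By the mean value theorem a difference quotient is a value of \<open>f'\<close> at
  distance less than the step size; uniform continuity of \<open>f'\<close> on the larger compact
  ball then gives uniform convergence. The gap between the radii leaves room for the shift.\<close>

lemma uniform_limit_diff_quot: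
  assumes "d < d'" "\<And>y. y \<in> cball z d' \<Longrightarrow> has_pd f i (f' y) y" "continuous_on (cball z d') f'"
  shows "uniform_limit (cball z d) (\<lambda>n. diff_quot (1 / real (Suc n)) i f) f' sequentially"
proof (rule uniform_limitI)
  fix e :: real assume "e > 0"
  have "uniformly_continuous_on (cball z d') f'"
    using assms(3) by (intro compact_uniformly_continuous compact_cball)
  then obtain r where r: "r > 0" "\<And>x y. x \<in> cball z d' \<Longrightarrow> y \<in> cball z d' \<Longrightarrow> dist y x < r
      \<Longrightarrow> dist (f' y) (f' x) < e"
    using \<open>e > 0\<close> unfolding uniformly_continuous_on_def by metis
  have "min r (d' - d) > 0" using r assms by simp
  then have "\<forall>\<^sub>F n in sequentially. 1 / real (Suc n) < min r (d' - d)"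
    using order_tendstoD(2)[OF LIMSEQ_inverse_real_of_nat] unfolding inverse_eq_divide by blast
  then show "\<forall>\<^sub>F n in sequentially. \<forall>x\<in>cball z d.
      dist (diff_quot (1 / real (Suc n)) i f x) (f' x) < e"
  proof eventually_elim
    case (elim n)
    define h where "h = 1 / real (Suc n)"
    have h: "0 < h" "h < r" "h < d' - d" using elim by (auto simp: h_def)
    show ?case
    proof
      fix x assume x: "x \<in> cball z d"
      have in': "x + t *\<^sub>R axis i 1 \<in> cball z d'" if "0 \<le> t" "t \<le> h" for t
        using x that h norm_triangle_ineq4[of "z - x" "t *\<^sub>R axis i 1"]
        by (simp add: dist_norm algebra_simps)
      have "\<exists>t>0. t < h \<and> f (x + h *\<^sub>R axis i 1) - f (x + 0 *\<^sub>R axis i 1)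
          = (h - 0) * f' (x + t *\<^sub>R axis i 1)"
        using h by (intro MVT2 has_pd_shift assms(2) in') auto
      then obtain t where t: "0 < t" "t < h" "f (x + h *\<^sub>R axis i 1) - f x
          = h * f' (x + t *\<^sub>R axis i 1)" by auto
      have "diff_quot h i f x = f' (x + t *\<^sub>R axis i 1)"
        using t h by (simp add: diff_quot_def)
      moreover have "dist (f' (x + t *\<^sub>R axis i 1)) (f' x) < e"
        using in'[of t] in'[of 0] t h by (intro r(2)) (auto simp: dist_norm)
      ultimately show "dist (diff_quot (1 / real (Suc n)) i f x) (f' x) < e"
        by (simp add: h_def)
    qed
  qed
qed

lemma continuous_on_diff_quot:
  assumes "continuous_on T f" "S \<subseteq> T" "(\<lambda>x. x + h *\<^sub>R axis i 1) ` S \<subseteq> T"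
  shows "continuous_on S (diff_quot h i f)"
proof -
  have "continuous_on S (\<lambda>x. f (x + h *\<^sub>R axis i 1))"
    using assms by (intro continuous_on_compose2[OF assms(1)] continuous_intros) auto
  moreover have "continuous_on S f" using assms continuous_on_subset by blast
  ultimately show ?thesis
    unfolding diff_quot_def divide_inverse by (intro continuous_intros)
qed


lemma uniform_limit_sum:
  fixes f :: "'i \<Rightarrow> nat \<Rightarrow> 'a \<Rightarrow> real"
  assumes "\<And>i. i \<in> I \<Longrightarrow> uniform_limit S (f i) (g i) F"
  shows "uniform_limit S (\<lambda>n x. \<Sum>i\<in>I. f i n x) (\<lambda>x. \<Sum>i\<in>I. g i x) F"
  using assms
proof (induction I rule: infinite_finite_induct)
  case (insert i I)
  then show ?case by (simp add: uniform_limit_add)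
qed (simp_all add: uniform_limit_const)

text \<open>Products preserve uniform convergence when the limits are bounded, which compactness and
  continuity supply.\<close>

lemma uniform_limit_mult_continuous:
  fixes f g :: "'a::metric_space \<Rightarrow> real"
  assumes "uniform_limit S F f net" "uniform_limit S G g net"
    and "compact S" "continuous_on S f" "continuous_on S g"
  shows "uniform_limit S (\<lambda>n x. F n x * G n x) (\<lambda>x. f x * g x) net"
  using assms by (intro uniform_lim_mult compact_imp_bounded compact_continuous_image)

lemma has_pd_diff_quot:
  assumes "has_pd f j D x" "has_pd f j E (x + h *\<^sub>R axis i 1)"
  shows "has_pd (diff_quot h i f) j ((E - D) / h) x"
  using assms(1) has_pd_translate[OF assms(2)] unfolding diff_quot_def has_pd_def
  by (intro DERIV_cdivide DERIV_diff)

text \<open>Here \<open>l\<close> is only \<open>C\<^sup>2\<close>, so \<open>\<bar>\<nabla>l\<bar>\<^sup>2\<close> need not have a Laplacian and the Bochner formula holds only in a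
  viscosity sense. The sums of squared difference quotients of \<open>l\<close> are \<open>C\<^sup>2\<close>; they converge uniformly to
  \<open>\<bar>\<nabla>l\<bar>\<^sup>2\<close> and their Laplacians converge uniformly to the Bochner expression, because difference quotients
  commute with the Laplacian.\<close>

lemma bochner_touching:
  fixes z :: "real^'n::finite"
  assumes U: "open U" "z \<in> U"
    and l: "continuous_on U l" "\<And>i x. x \<in> U \<Longrightarrow> has_pd l i (l1 i x) x"
    and l1: "\<And>i. continuous_on U (l1 i)"
      "\<And>i j x. x \<in> U \<Longrightarrow> has_pd (l1 j) i (l2 i j x) x"
    and l2: "\<And>i j. continuous_on U (l2 i j)"
    and g: "\<And>x. x \<in> U \<Longrightarrow> g x = (\<Sum>i\<in>UNIV. l2 i i x)"
      "\<And>i x. x \<in> U \<Longrightarrow> has_pd g i (g1 i x) x" "\<And>i. continuous_on U (g1 i)"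
    and Q: "continuous_on U Q" "\<And>i x. x \<in> U \<Longrightarrow> has_pd Q i (Q1 i x) x"
      "\<And>i x. x \<in> U \<Longrightarrow> has_pd (Q1 i) i (Q2 i x) x" "\<And>i. continuous_on U (Q2 i)"
    and touch: "\<And>x. x \<in> U \<Longrightarrow> (\<Sum>i\<in>UNIV. (l1 i x)\<^sup>2) \<le> Q x"
      "(\<Sum>i\<in>UNIV. (l1 i z)\<^sup>2) = Q z"
  shows "2 * (\<Sum>i\<in>UNIV. \<Sum>j\<in>UNIV. (l2 i j z)\<^sup>2) + 2 * (\<Sum>i\<in>UNIV. l1 i z * g1 i z)
      \<le> (\<Sum>i\<in>UNIV. Q2 i z)"
proof (rule ccontr)
  define T where "T x = 2 * (\<Sum>i\<in>UNIV. \<Sum>j\<in>UNIV. l2 i j x * l2 i j x)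
      + 2 * (\<Sum>i\<in>UNIV. l1 i x * g1 i x)" for x
  define s where "s x = (\<Sum>i\<in>UNIV. l1 i x * l1 i x)" for x
  \<comment> \<open>Half of the gap by which the claim is supposed to fail at \<open>z\<close>; by
    continuity the gap stays above \<open>e\<close> on a whole ball.\<close>
  define e where "e = (T z - (\<Sum>i\<in>UNIV. Q2 i z)) / 2"
  assume "\<not> ?thesis"
  then have e: "e > 0" by (simp add: e_def T_def power2_eq_square)
  have "continuous_on U (\<lambda>x. T x - (\<Sum>i\<in>UNIV. Q2 i x))"
    unfolding T_def by (intro continuous_on_diff continuous_on_add continuous_on_mult
        continuous_on_sum continuous_on_const l1(1) l2 g(3) Q(4))
  then have "open (U \<inter> (\<lambda>x. T x - (\<Sum>i\<in>UNIV. Q2 i x)) -` {e<..})"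
    using U(1) by (intro continuous_open_preimage) auto
  moreover have "z \<in> U \<inter> (\<lambda>x. T x - (\<Sum>i\<in>UNIV. Q2 i x)) -` {e<..}"
    using U e by (simp add: e_def)
  ultimately obtain d' where d': "d' > 0"
      "cball z d' \<subseteq> U \<inter> (\<lambda>x. T x - (\<Sum>i\<in>UNIV. Q2 i x)) -` {e<..}"
    using open_contains_cball by metis
  define d where "d = d' / 2"
  have d: "d > 0" "d < d'" using d' by (auto simp: d_def)
  have sub': "cball z d' \<subseteq> U" using d' by auto
  have sub: "cball z d \<subseteq> U" "cball z d \<subseteq> cball z d'" using sub' d by (auto simp: subset_iff)
  have lower: "T x - (\<Sum>i\<in>UNIV. Q2 i x) > e" if "x \<in> cball z d" for x
    using d'(2) sub(2) that by auto
  have cont: "continuous_on (cball z d) f" "continuous_on (cball z d') f"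
    if "continuous_on U f" for f :: "real^'n \<Rightarrow> real"
    using that sub sub' continuous_on_subset by blast+
  define h where "h n = 1 / real (Suc n)" for n
  \<comment> \<open>The penalty \<open>\<kappa> * (norm (x - z))\<^sup>2\<close> then has Laplacian
    \<open>e / 2\<close>, the part of the gap that survives replacing \<open>T\<close> by
    \<open>T'\<close> with an error below \<open>e / 2\<close>.\<close>
  define \<kappa> where "\<kappa> = e / (4 * real CARD('n))"
  have \<kappa>: "\<kappa> > 0" "2 * real CARD('n) * \<kappa> = e / 2"
    using e by (auto simp: \<kappa>_def)
  define S where "S n x = (\<Sum>i\<in>UNIV. diff_quot (h n) i l x * diff_quot (h n) i l x)" for n x
  \<comment> \<open>This is the Laplacian of \<open>S n\<close>, since the Laplacian of a difference
    quotient of \<open>l\<close> is the difference quotient of \<open>g\<close>.\<close>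
  define T' where "T' n x = 2 * (\<Sum>i\<in>UNIV. \<Sum>j\<in>UNIV. diff_quot (h n) i (l1 j) x * diff_quot (h n) i (l1 j) x)
      + 2 * (\<Sum>i\<in>UNIV. diff_quot (h n) i l x * diff_quot (h n) i g x)" for n x
  have dq: "uniform_limit (cball z d) (\<lambda>n. diff_quot (h n) i f) f' sequentially"
    if "\<And>x. x \<in> U \<Longrightarrow> has_pd f i (f' x) x" "continuous_on U f'" for f f' i
    unfolding h_def using d sub' that
    by (intro uniform_limit_diff_quot[of d d']) (auto intro: continuous_on_subset)
  have "uniform_limit (cball z d) S s sequentially"
    unfolding S_def[abs_def] s_def[abs_def]
    by (intro uniform_limit_sum uniform_limit_mult_continuous dq cont(1) l(2) l1(1) compact_cball)
  moreover have "uniform_limit (cball z d) T' T sequentially"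
    unfolding T'_def[abs_def] T_def[abs_def]
    by (intro uniform_limit_sum uniform_limit_mult_continuous dq cont(1) l(2) l1 l2 g(2,3) compact_cball
        uniform_limit_add bounded_linear.uniform_limit[OF bounded_linear_mult_right])
  ultimately have "\<forall>\<^sub>F n in sequentially. (\<forall>x\<in>cball z d. dist (S n x) (s x) < \<kappa> * d\<^sup>2 / 2)
      \<and> (\<forall>x\<in>cball z d. dist (T' n x) (T x) < e / 2) \<and> h n < d' - d"
    using e \<kappa> d order_tendstoD(2)[OF LIMSEQ_inverse_real_of_nat, of "d' - d"]
    unfolding h_def inverse_eq_divide
    by (intro eventually_conj uniform_limitD) auto
  then obtain n where n: "\<And>x. x \<in> cball z d \<Longrightarrow> \<bar>S n x - s x\<bar> < \<kappa> * d\<^sup>2 / 2"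
      "\<And>x. x \<in> cball z d \<Longrightarrow> \<bar>T' n x - T x\<bar> < e / 2" "h n < d' - d"
    unfolding dist_real_def eventually_sequentially by blast
  have hn: "h n > 0" by (simp add: h_def)
  have shift: "x + h n *\<^sub>R axis i 1 \<in> cball z d'" if "x \<in> cball z d" for x i
    using that n(3) hn norm_triangle_ineq4[of "z - x" "h n *\<^sub>R axis i 1"]
    by (simp add: dist_norm algebra_simps)
  \<comment> \<open>The limit \<open>s - Q\<close> may attain its maximum at many points besides
    \<open>z\<close>, so a quadratic penalty is subtracted to keep the maximum point of the
    approximation off the boundary of the ball.\<close>
  define G where "G x = S n x - Q x - \<kappa> * (norm (x - z))\<^sup>2" for x
  have "continuous_on (cball z d) (\<lambda>x. diff_quot (h n) i l x)" for i
    by (intro continuous_on_diff_quot[OF cont(2)[OF l(1)]]) (use sub shift in auto)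
  then have "continuous_on (cball z d) G"
    unfolding G_def S_def by (intro continuous_on_diff continuous_on_mult continuous_on_sum
        continuous_on_const continuous_on_power continuous_on_norm continuous_on_id cont(1)[OF Q(1)])
  then obtain y where y: "y \<in> cball z d" "\<And>x. x \<in> cball z d \<Longrightarrow> G x \<le> G y"
    using continuous_attains_sup[of "cball z d" G] d by (metis cball_eq_empty compact_cball less_le_not_le not_less)
  have "s y \<le> Q y" "s z = Q z"
    using touch y sub by (auto simp: s_def power2_eq_square)
  moreover have "\<bar>S n z - s z\<bar> < \<kappa> * d\<^sup>2 / 2" "\<bar>S n y - s y\<bar> < \<kappa> * d\<^sup>2 / 2"
    using n(1)[of z] n(1)[of y] y(1) d by auto
  \<comment> \<open>With \<open>S n\<close> within \<open>\<kappa> * d\<^sup>2 / 2\<close> of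
    \<open>s\<close>, comparing \<open>G z\<close> with the maximum \<open>G y\<close> forces
    \<open>norm (y - z) < d\<close>, so \<open>y\<close> is an interior maximum.\<close>
  ultimately have "G z > - (\<kappa> * d\<^sup>2 / 2)" "G y < \<kappa> * d\<^sup>2 / 2 - \<kappa> * (norm (y - z))\<^sup>2"
    unfolding G_def by (simp_all only: diff_self norm_zero power_zero_numeral mult_zero_right abs_less_iff, linarith+)
  then have "\<kappa> * (norm (y - z))\<^sup>2 < \<kappa> * d\<^sup>2"
    using y(2)[of z] d by simp
  then have "y \<in> ball z d"
    using \<kappa> d by (simp add: dist_norm norm_minus_commute power2_less_imp_less)
  have pd: "has_pd (diff_quot (h n) i f) j (diff_quot (h n) i f' x) x"
    if "x \<in> cball z d" "\<And>x. x \<in> U \<Longrightarrow> has_pd f j (f' x) x" for f f' i j x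
    unfolding diff_quot_def[of _ _ f']
    using that shift[OF that(1), of i] sub sub' by (intro has_pd_diff_quot) auto
  define G1 where "G1 j x = (\<Sum>i\<in>UNIV. 2 * (diff_quot (h n) i l x * diff_quot (h n) i (l1 j) x))
      - Q1 j x - \<kappa> * (2 * (x $ j - z $ j))" for j x
  define G2 where "G2 j x = (\<Sum>i\<in>UNIV. 2 * (diff_quot (h n) i (l1 j) x * diff_quot (h n) i (l1 j) x
      + diff_quot (h n) i (l2 j j) x * diff_quot (h n) i l x)) - Q2 j x - \<kappa> * (2 * 1)" for j x
  have G1: "has_pd G j (G1 j x) x" if "x \<in> cball z d" for x j
  proof -
    have "has_pd (S n) j (\<Sum>i\<in>UNIV. diff_quot (h n) i (l1 j) x * diff_quot (h n) i l x
        + diff_quot (h n) i (l1 j) x * diff_quot (h n) i l x) x"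
      unfolding S_def[abs_def] by (intro has_pd_sum has_pd_mult pd that l(2))
    then have "has_pd (S n) j (\<Sum>i\<in>UNIV. 2 * (diff_quot (h n) i l x * diff_quot (h n) i (l1 j) x)) x"
      by (simp add: mult.commute)
    then show ?thesis
      unfolding G_def[abs_def] G1_def using that sub
      by (intro has_pd_diff has_pd_cmult has_pd_dist_sq Q) auto
  qed
  have G2: "has_pd (G1 j) j (G2 j x) x" if "x \<in> cball z d" for x j
  proof -
    have coord: "has_pd (\<lambda>x. x $ j - z $ j) j 1 x"
      using has_pd_coord[of j z j x] by simp
    show ?thesis
      unfolding G1_def[abs_def] G2_def using that sub
      by (intro has_pd_diff has_pd_sum has_pd_cmult has_pd_mult coord pd Q l l1) auto
  qed
  have "G2 j y \<le> 0" for j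
  proof (rule second_pd_nonpos_at_max)
    show "has_pd G j (G1 j x) x" if "x \<in> ball z d" for x using that by (intro G1) auto
    show "has_pd (G1 j) j (G2 j y) y" using y by (intro G2)
  qed (use \<open>y \<in> ball z d\<close> y in auto)
  then have "(\<Sum>j\<in>UNIV. G2 j y) \<le> 0" by (simp add: sum_nonpos)
  moreover have "(\<Sum>j\<in>UNIV. G2 j y) = T' n y - (\<Sum>j\<in>UNIV. Q2 j y) - 2 * real CARD('n) * \<kappa>"
  proof -
    \<comment> \<open>The relation between \<open>g\<close> and \<open>l2\<close> is used at
      \<open>y\<close> and at the shifted point, so both must lie in \<open>U\<close>.\<close>
    have "(\<Sum>j\<in>UNIV. diff_quot (h n) i (l2 j j) y) = diff_quot (h n) i g y" for i
    proof -
      have "y \<in> U" "y + h n *\<^sub>R axis i 1 \<in> U" using y shift sub sub' by blast+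
      then show ?thesis
        by (simp add: diff_quot_def g(1) sum_divide_distrib[symmetric] sum_subtractf)
    qed
    then have "(\<Sum>j\<in>UNIV. \<Sum>i\<in>UNIV. diff_quot (h n) i (l2 j j) y * diff_quot (h n) i l y)
        = (\<Sum>i\<in>UNIV. diff_quot (h n) i g y * diff_quot (h n) i l y)"
      by (subst sum.swap) (simp add: sum_distrib_right[symmetric])
    moreover have "(\<Sum>j\<in>UNIV. \<Sum>i\<in>UNIV. diff_quot (h n) i (l1 j) y * diff_quot (h n) i (l1 j) y)
        = (\<Sum>i\<in>UNIV. \<Sum>j\<in>UNIV. diff_quot (h n) i (l1 j) y * diff_quot (h n) i (l1 j) y)"
      by (rule sum.swap)
    ultimately show ?thesis
      by (simp add: G2_def T'_def sum.distrib sum_subtractf sum_distrib_left[symmetric]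
          mult.commute[of "diff_quot (h n) _ g y"])
  qed
  ultimately show False
    using lower[OF y(1)] n(2)[OF y(1)] \<kappa> by (simp add: abs_less_iff)
qed

subsection \<open>The Bernstein inequality at a maximum point\<close>

text \<open>Cauchy-Schwarz on the diagonal, after which the squares of the off-diagonal entries are
  added.\<close>

lemma trace_sq_le:
  fixes E :: "'n::finite \<Rightarrow> 'n \<Rightarrow> real"
  shows "(\<Sum>i\<in>UNIV. E i i)\<^sup>2 / real CARD('n) \<le> (\<Sum>i\<in>UNIV. \<Sum>j\<in>UNIV. (E i j)\<^sup>2)"
proof -
  have "(\<Sum>i\<in>UNIV. E i i)\<^sup>2 \<le> (\<Sum>i\<in>UNIV. (E i i)\<^sup>2) * real CARD('n)"
    using sum_squared_le_sum_of_squares[of "\<lambda>i. E i i" UNIV] by simp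
  also have "\<dots> \<le> (\<Sum>i\<in>UNIV. \<Sum>j\<in>UNIV. (E i j)\<^sup>2) * real CARD('n)"
    by (intro mult_right_mono sum_mono member_le_sum[where f = "\<lambda>j. (E _ j)\<^sup>2"]) auto
  finally show ?thesis by (simp add: field_simps)
qed

text \<open>The shift by \<open>k\<close> amounts to applying the trace inequality to a power of \<open>u\<close>
  instead of \<open>ln u\<close>.\<close>

lemma bernstein_algebra:
  fixes a P L :: "'n::finite \<Rightarrow> real" and D :: "'n \<Rightarrow> 'n \<Rightarrow> real"
    and s A B p q k m \<sigma> :: real
  defines "N \<equiv> real CARD('n)" and "b \<equiv> \<Sum>i\<in>UNIV. a i * P i"
    and "d \<equiv> \<lambda>i. - (\<sigma> * a i + m * P i) * s"
  assumes s: "s = (\<Sum>i\<in>UNIV. (a i)\<^sup>2)" "s > 0"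
    and first: "\<And>i. 2 * (\<Sum>j\<in>UNIV. a j * D i j) = d i"
    and trace: "(\<Sum>i\<in>UNIV. D i i) = - (s + A + B)"
    and touch: "2 * (\<Sum>i\<in>UNIV. \<Sum>j\<in>UNIV. (D i j)\<^sup>2)
        + 2 * (\<Sum>i\<in>UNIV. a i * - (d i + (p - 1) * A * a i + (q - 1) * B * a i + q / 2 * B * d i / s))
      \<le> (\<Sum>i\<in>UNIV. ((\<sigma> * a i + m * P i)\<^sup>2 - (\<sigma> * D i i + m * L i)) * s)"
  shows "(s * (1 - k) + A + B)\<^sup>2 / N + (k + 1) * \<sigma> * s\<^sup>2 - k\<^sup>2 * s\<^sup>2
      - (p - 1) * A * s - (q - 1) * B * s + q / 2 * \<sigma> * B * s
      - \<sigma>\<^sup>2 * s\<^sup>2 / 2 - \<sigma> * s * (s + A + B) / 2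
    \<le> (\<sigma> - (k + 1)) * m * (s * b) - q / 2 * m * (B * b)
      + m\<^sup>2 / 2 * (\<Sum>i\<in>UNIV. (P i)\<^sup>2) * s - m / 2 * (\<Sum>i\<in>UNIV. L i) * s"
proof -
  let ?D2 = "\<Sum>i\<in>UNIV. \<Sum>j\<in>UNIV. (D i j)\<^sup>2"
  have d: "(\<Sum>i\<in>UNIV. a i * d i) = - s * (\<sigma> * s + m * b)"
  proof -
    have "(\<Sum>i\<in>UNIV. a i * d i) = - s * (\<sigma> * (\<Sum>i\<in>UNIV. (a i)\<^sup>2) + m * b)"
      unfolding d_def b_def
      by (simp add: sum_distrib_left sum.distrib[symmetric] sum_negf[symmetric]
          power2_eq_square algebra_simps)
    then show ?thesis by (simp only: s(1)[symmetric])
  qed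
  \<comment> \<open>In the expanded square the mixed term is \<open>D\<close> applied twice to
    \<open>a\<close>, which the first-order condition \<open>first\<close> evaluates. The trace
    inequality is then applied to this shifted matrix.\<close>
  have "(\<Sum>i\<in>UNIV. \<Sum>j\<in>UNIV. (D i j + k * (a i * a j))\<^sup>2)
      = ?D2 + k * (\<Sum>i\<in>UNIV. a i * (2 * (\<Sum>j\<in>UNIV. a j * D i j)))
        + k\<^sup>2 * (\<Sum>i\<in>UNIV. \<Sum>j\<in>UNIV. (a i)\<^sup>2 * (a j)\<^sup>2)"
    by (simp add: sum_distrib_left sum.distrib[symmetric] power2_eq_square algebra_simps)
  also have "(\<Sum>i\<in>UNIV. \<Sum>j\<in>UNIV. (a i)\<^sup>2 * (a j)\<^sup>2) = s\<^sup>2"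
    unfolding s(1) power2_eq_square[of "sum _ _"] by (rule sum_product[symmetric])
  also have "(\<Sum>i\<in>UNIV. a i * (2 * (\<Sum>j\<in>UNIV. a j * D i j))) = - s * (\<sigma> * s + m * b)"
    by (simp only: first d)
  finally have "(\<Sum>i\<in>UNIV. D i i + k * (a i * a i))\<^sup>2 / N
      \<le> ?D2 + k * (- s * (\<sigma> * s + m * b)) + k\<^sup>2 * s\<^sup>2"
    using trace_sq_le[of "\<lambda>i j. D i j + k * (a i * a j)"] unfolding N_def by simp
  moreover have "(\<Sum>i\<in>UNIV. D i i + k * (a i * a i)) = - (s + A + B) + k * s"
    unfolding sum.distrib trace sum_distrib_left[symmetric] s(1) by (simp add: power2_eq_square)
  moreover have "(- (s + A + B) + k * s)\<^sup>2 = (s * (1 - k) + A + B)\<^sup>2"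
    by (simp add: power2_eq_square algebra_simps)
  ultimately have D2: "(s * (1 - k) + A + B)\<^sup>2 / N
      \<le> ?D2 + k * (- s * (\<sigma> * s + m * b)) + k\<^sup>2 * s\<^sup>2" by simp
  have "(\<Sum>i\<in>UNIV. a i * - (d i + e * a i + f * a i + r * d i))
      = - ((1 + r) * (\<Sum>i\<in>UNIV. a i * d i) + (e + f) * (\<Sum>i\<in>UNIV. (a i)\<^sup>2))" for e f r
    by (simp add: sum_distrib_left sum.distrib[symmetric] sum_negf[symmetric]
        power2_eq_square algebra_simps)
  from this[of "(p - 1) * A" "(q - 1) * B" "q / 2 * B / s"]
  have "(\<Sum>i\<in>UNIV. a i * - (d i + (p - 1) * A * a i + (q - 1) * B * a i + q / 2 * B * d i / s))
      = - ((1 + q / 2 * B / s) * (\<Sum>i\<in>UNIV. a i * d i)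
        + ((p - 1) * A + (q - 1) * B) * (\<Sum>i\<in>UNIV. (a i)\<^sup>2))"
    by (simp only: times_divide_eq_left)
  also have "\<dots> = (s + q / 2 * B) * (\<sigma> * s + m * b) - ((p - 1) * A + (q - 1) * B) * s"
    unfolding d s(1)[symmetric] using s(2) by (simp add: field_simps)
  finally have X: "(\<Sum>i\<in>UNIV. a i * - (d i + (p - 1) * A * a i + (q - 1) * B * a i + q / 2 * B * d i / s))
      = \<dots>" .
  have "(\<Sum>i\<in>UNIV. ((\<sigma> * a i + m * P i)\<^sup>2 - (\<sigma> * D i i + m * L i)) * s)
      = (\<sigma>\<^sup>2 * (\<Sum>i\<in>UNIV. (a i)\<^sup>2) + 2 * \<sigma> * m * b + m\<^sup>2 * (\<Sum>i\<in>UNIV. (P i)\<^sup>2)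
         - \<sigma> * (\<Sum>i\<in>UNIV. D i i) - m * (\<Sum>i\<in>UNIV. L i)) * s"
    unfolding b_def
    by (simp add: sum_distrib_left sum_distrib_right sum.distrib[symmetric] sum_subtractf[symmetric]
        power2_eq_square algebra_simps)
  also have "\<dots> = (\<sigma>\<^sup>2 * s + 2 * \<sigma> * m * b + m\<^sup>2 * (\<Sum>i\<in>UNIV. (P i)\<^sup>2)
         + \<sigma> * (s + A + B) - m * (\<Sum>i\<in>UNIV. L i)) * s"
    unfolding trace s(1)[symmetric] by (simp add: algebra_simps)
  finally have "2 * ?D2 + 2 * ((s + q / 2 * B) * (\<sigma> * s + m * b) - ((p - 1) * A + (q - 1) * B) * s)
    \<le> (\<sigma>\<^sup>2 * s + 2 * \<sigma> * m * b + m\<^sup>2 * (\<Sum>i\<in>UNIV. (P i)\<^sup>2)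
         + \<sigma> * (s + A + B) - m * (\<Sum>i\<in>UNIV. L i)) * s"
    using touch X by simp
  \<comment> \<open>The claim is \<open>D2\<close> plus half of the touching inequality. Naming the
    sums \<open>T\<close>, \<open>X\<close>, \<open>SP\<close>, \<open>SL\<close> reduces this to a
    polynomial identity.\<close>
  moreover have "T + (k + 1) * \<sigma> * s\<^sup>2 - k\<^sup>2 * s\<^sup>2
      - (p - 1) * A * s - (q - 1) * B * s + q / 2 * \<sigma> * B * s
      - \<sigma>\<^sup>2 * s\<^sup>2 / 2 - \<sigma> * s * (s + A + B) / 2
    \<le> (\<sigma> - (k + 1)) * m * (s * b) - q / 2 * m * (B * b) + m\<^sup>2 / 2 * SP * s - m / 2 * SL * s"
    if "T \<le> X + k * (- s * (\<sigma> * s + m * b)) + k\<^sup>2 * s\<^sup>2"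
      "2 * X + 2 * ((s + q / 2 * B) * (\<sigma> * s + m * b) - ((p - 1) * A + (q - 1) * B) * s)
        \<le> (\<sigma>\<^sup>2 * s + 2 * \<sigma> * m * b + m\<^sup>2 * SP + \<sigma> * (s + A + B) - m * SL) * s"
    for T X SP SL
  proof -
    have "((\<sigma> - (k + 1)) * m * (s * b) - q / 2 * m * (B * b) + m\<^sup>2 / 2 * SP * s - m / 2 * SL * s)
      - (T + (k + 1) * \<sigma> * s\<^sup>2 - k\<^sup>2 * s\<^sup>2
        - (p - 1) * A * s - (q - 1) * B * s + q / 2 * \<sigma> * B * s
        - \<sigma>\<^sup>2 * s\<^sup>2 / 2 - \<sigma> * s * (s + A + B) / 2)
      = (X + k * (- s * (\<sigma> * s + m * b)) + k\<^sup>2 * s\<^sup>2 - T)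
        + ((\<sigma>\<^sup>2 * s + 2 * \<sigma> * m * b + m\<^sup>2 * SP + \<sigma> * (s + A + B) - m * SL) * s
          - (2 * X + 2 * ((s + q / 2 * B) * (\<sigma> * s + m * b) - ((p - 1) * A + (q - 1) * B) * s))) / 2"
      by (simp add: field_simps power2_eq_square)
    moreover have "y \<le> x" if "x - y = (v - t) + (w - u) / 2" "t \<le> v" "u \<le> w" for x y t u v w :: real
      using that by argo
    ultimately show ?thesis using that by blast
  qed
  ultimately show ?thesis using D2 by blast
qed

text \<open>The value of \<open>k\<close> maximises the admissible range of \<open>p\<close>: for \<open>\<sigma> = 0\<close> the coefficient of \<open>s\<^sup>2\<close> is
  then \<open>1 / N\<close>, and the coefficient of \<open>s * A\<close> exceeds \<open>- 2 / N\<close> precisely when \<open>p < (N + 3) / (N - 1)\<close>.\<close>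

lemma form_coercive:
  fixes N p q :: real
  defines "k \<equiv> - 2 / (N - 1)"
  assumes "N \<ge> 2" "1 < p" "p < (N + 3) / (N - 1)" "1 < q" "q < (N + 2) / N"
  shows "\<exists>\<sigma>>0. \<exists>c>0. \<forall>s A B. s \<ge> 0 \<longrightarrow> A \<ge> 0 \<longrightarrow> B \<ge> 0 \<longrightarrow>
    c * (s\<^sup>2 + A\<^sup>2 + B\<^sup>2) \<le> (s * (1 - k) + A + B)\<^sup>2 / N
      + (k + 1) * \<sigma> * s\<^sup>2 - k\<^sup>2 * s\<^sup>2
      - (p - 1) * A * s - (q - 1) * B * s + q / 2 * \<sigma> * B * s
      - \<sigma>\<^sup>2 * s\<^sup>2 / 2 - \<sigma> * s * (s + A + B) / 2"
proof -
  \<comment> \<open>The slack in the bound on \<open>p\<close>: for \<sigma> = 0 the coefficient of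
    \<open>s * A\<close> is \<open>- 2 / N + \<eta>\<close>.\<close>
  define \<eta> where "\<eta> = 4 / (N - 1) - (p - 1)"
  have "\<eta> > 0" using assms by (simp add: \<eta>_def field_simps)
  \<comment> \<open>The bound 1 controls the terms in \<sigma> on \<open>s\<^sup>2\<close>,
    \<open>\<eta> / 4\<close> lets the slack cover \<open>2 * e\<close> and
    \<open>\<sigma> / 2\<close>, and \<open>1 / N\<close> keeps \<open>1 / N - e\<close> nonnegative
    and \<open>e * B\<^sup>2\<close> below \<open>B\<^sup>2 / N\<close>.\<close>
  define e where "e = min 1 (min (\<eta> / 4) (1 / N))"
  have e: "e > 0" "e \<le> 1" "e \<le> \<eta> / 4" "e \<le> 1 / N"
    using \<open>\<eta> > 0\<close> assms by (auto simp: e_def)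
  define \<sigma> where "\<sigma> = e / 4"
  have k: "- 2 \<le> k" "k < 0" using assms by (auto simp: k_def field_simps)
  \<comment> \<open>This is where the upper bound on \<open>q\<close> enters: it makes the
    coefficient of \<open>s * B\<close> nonnegative, because \<open>k < 0\<close>.\<close>
  have q: "q - 1 < 2 / N" using assms by (simp add: field_simps)
  have p: "2 * (1 - k) / N - (p - 1) = - 2 / N + \<eta>"
    using assms by (simp add: \<eta>_def k_def divide_simps) (simp add: algebra_simps)
  have k2: "(1 - k)\<^sup>2 / N - k\<^sup>2 = 1 / N"
    using assms by (simp add: k_def power2_eq_square divide_simps) (simp add: algebra_simps)
  have main: "e / 2 * (s\<^sup>2 + A\<^sup>2 + B\<^sup>2) \<le> (s * (1 - k) + A + B)\<^sup>2 / N
      + (k + 1) * \<sigma> * s\<^sup>2 - k\<^sup>2 * s\<^sup>2 - (p - 1) * A * s - (q - 1) * B * s + q / 2 * \<sigma> * B * s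
      - \<sigma>\<^sup>2 * s\<^sup>2 / 2 - \<sigma> * s * (s + A + B) / 2"
    if nn: "s \<ge> 0" "A \<ge> 0" "B \<ge> 0" for s A B
  proof -
    let ?F = "(s * (1 - k) + A + B)\<^sup>2 / N
      + (k + 1) * \<sigma> * s\<^sup>2 - k\<^sup>2 * s\<^sup>2 - (p - 1) * A * s - (q - 1) * B * s + q / 2 * \<sigma> * B * s
      - \<sigma>\<^sup>2 * s\<^sup>2 / 2 - \<sigma> * s * (s + A + B) / 2"
    have "?F = ((1 - k)\<^sup>2 / N - k\<^sup>2 + (k + 1) * \<sigma> - \<sigma>\<^sup>2 / 2 - \<sigma> / 2) * s\<^sup>2
        + (2 * (1 - k) / N - (p - 1) - \<sigma> / 2) * (s * A)
        + (2 * (1 - k) / N - (q - 1) + (q - 1) * \<sigma> / 2) * (s * B)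
        + A\<^sup>2 / N + B\<^sup>2 / N + 2 / N * (A * B)"
      using assms(2) by (simp add: field_simps power2_eq_square)
    also have "\<dots> = (1 / N + (k + 1 / 2 - \<sigma> / 2) * \<sigma>) * s\<^sup>2
        + (- 2 / N + \<eta> - \<sigma> / 2) * (s * A)
        + (2 * (1 - k) / N - (q - 1) + (q - 1) * \<sigma> / 2) * (s * B)
        + A\<^sup>2 / N + B\<^sup>2 / N + 2 / N * (A * B)"
      unfolding k2 p by (simp add: algebra_simps power2_eq_square)
    finally have F: "?F = \<dots>" .
    have "(- 2) * \<sigma> \<le> (k + 1 / 2 - \<sigma> / 2) * \<sigma>"
      using k e by (intro mult_right_mono) (auto simp: \<sigma>_def)
    then have 1: "(1 / N - 2 * \<sigma>) * s\<^sup>2 \<le> (1 / N + (k + 1 / 2 - \<sigma> / 2) * \<sigma>) * s\<^sup>2"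
      by (intro mult_right_mono) auto
    have 2: "(- 2 / N + 2 * e) * (s * A) \<le> (- 2 / N + \<eta> - \<sigma> / 2) * (s * A)"
      using nn e by (intro mult_right_mono) (auto simp: \<sigma>_def)
    have "2 / N \<le> 2 * (1 - k) / N" using k assms by (simp add: divide_right_mono)
    moreover have "0 \<le> (q - 1) * \<sigma> / 2" using assms e by (simp add: \<sigma>_def)
    ultimately have 3: "0 \<le> (2 * (1 - k) / N - (q - 1) + (q - 1) * \<sigma> / 2) * (s * B)"
      using nn q by (intro mult_nonneg_nonneg) auto
    have 4: "0 \<le> 2 / N * (A * B)" using nn assms by simp
    \<comment> \<open>Only the product \<open>s * A\<close> can have a negative coefficient; this
      square absorbs it and leaves \<open>e - 2 * \<sigma> = e / 2\<close> in front of
      \<open>s\<^sup>2\<close>.\<close>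
    have "0 \<le> (1 / N - e) * (s - A)\<^sup>2" using e by simp
    then have 5: "(- 2 / N + 2 * e) * (s * A) \<ge> - (1 / N - e) * (s\<^sup>2 + A\<^sup>2)"
      by (simp add: power2_eq_square algebra_simps)
    have 6: "e * B\<^sup>2 \<le> B\<^sup>2 / N" using mult_right_mono[OF e(4), of "B\<^sup>2"] by simp
    have 7: "0 \<le> e * A\<^sup>2" "0 \<le> e * B\<^sup>2" using e by auto
    have "e / 2 * (s\<^sup>2 + A\<^sup>2 + B\<^sup>2) \<le> (1 / N - 2 * \<sigma>) * s\<^sup>2 - (1 / N - e) * (s\<^sup>2 + A\<^sup>2) + A\<^sup>2 / N + B\<^sup>2 / N"
      using 6 7 by (simp add: \<sigma>_def algebra_simps)
    also have "\<dots> \<le> ?F" unfolding F using 1 2 3 4 5 by linarith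
    finally show ?thesis .
  qed
  show ?thesis
    using main e
    by (intro exI[of _ \<sigma>] conjI exI[of _ "e / 2"] allI impI) (auto simp: \<sigma>_def)
qed

text \<open>Since \<open>b\<close> is of order \<tau> times the square root of \<open>s\<close>,
  Young's inequality reduces the right-hand side to small multiples of squares plus a multiple of
  \<open>\<tau>\<^sup>2 * s\<close>. One more use of it bounds \<open>s\<close> and \<open>A\<close>
  by multiples of \<open>\<tau>\<^sup>2\<close>.\<close>

lemma absorb_errors:
  fixes c K :: real
  assumes "c > 0" "K \<ge> 0"
  shows "\<exists>C>0. \<forall>s A B \<tau> b. s \<ge> 0 \<longrightarrow> A \<ge> 0 \<longrightarrow> B \<ge> 0 \<longrightarrow> b\<^sup>2 \<le> 4 * \<tau>\<^sup>2 * s \<longrightarrow>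
     c * (s\<^sup>2 + A\<^sup>2 + B\<^sup>2) \<le> K * (s * \<bar>b\<bar> + B * \<bar>b\<bar> + \<tau>\<^sup>2 * s) \<longrightarrow> s \<le> C * \<tau>\<^sup>2 \<and> A \<le> C * \<tau>\<^sup>2"
proof -
  \<comment> \<open>The two products with \<open>b\<close> cost
    \<open>5 / 4 * k\<^sup>2 * b\<^sup>2\<close>, at most \<open>5 * k\<^sup>2 * t * s\<close>, for
    \<open>k = K / c\<close> and \<open>t = \<tau>\<^sup>2\<close>; the last error adds
    \<open>k * t * s\<close>. The final constant \<open>2 * L + 1\<close> stays positive even for
    \<open>K = 0\<close>.\<close>
  define L where "L = 5 * (K / c)\<^sup>2 + K / c"
  have L: "L \<ge> 0" using assms by (simp add: L_def)
  have "s \<le> (2 * L + 1) * \<tau>\<^sup>2 \<and> A \<le> (2 * L + 1) * \<tau>\<^sup>2"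
    if *: "s \<ge> 0" "A \<ge> 0" "B \<ge> 0" "b\<^sup>2 \<le> 4 * \<tau>\<^sup>2 * s"
      "c * (s\<^sup>2 + A\<^sup>2 + B\<^sup>2) \<le> K * (s * \<bar>b\<bar> + B * \<bar>b\<bar> + \<tau>\<^sup>2 * s)" for s A B \<tau> b
  proof -
    define k t where "k = K / c" and "t = \<tau>\<^sup>2"
    have k: "k \<ge> 0" "t \<ge> 0" using assms by (auto simp: k_def t_def)
    have 1: "s\<^sup>2 + A\<^sup>2 + B\<^sup>2 \<le> k * s * \<bar>b\<bar> + k * B * \<bar>b\<bar> + k * t * s"
      using *(5) assms by (simp add: field_simps k_def t_def)
    have 2: "k * s * \<bar>b\<bar> \<le> s\<^sup>2 / 4 + k\<^sup>2 * b\<^sup>2"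
      using zero_le_power2[of "s / 2 - k * \<bar>b\<bar>"] by (simp add: power2_diff power_mult_distrib power_divide mult_ac)
    have 3: "k * B * \<bar>b\<bar> \<le> B\<^sup>2 + k\<^sup>2 * b\<^sup>2 / 4"
      using zero_le_power2[of "B - k * \<bar>b\<bar> / 2"] by (simp add: power2_diff power_mult_distrib power_divide mult_ac)
    have "k\<^sup>2 * b\<^sup>2 \<le> k\<^sup>2 * (4 * t * s)"
      using * by (intro mult_left_mono) (auto simp: t_def)
    then have 4: "3 / 4 * s\<^sup>2 + A\<^sup>2 \<le> (5 * k\<^sup>2 + k) * t * s"
      using 1 2 3 by (simp add: algebra_simps)
    have Lk: "5 * k\<^sup>2 + k = L" by (simp add: L_def k_def)
    have "L * t * s \<le> s\<^sup>2 / 4 + (L * t)\<^sup>2"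
      using zero_le_power2[of "s / 2 - L * t"] by (simp add: power2_diff power_mult_distrib power_divide mult_ac)
    then have 5: "s\<^sup>2 / 2 + A\<^sup>2 \<le> (L * t)\<^sup>2" using 4 unfolding Lk by simp
    have "s\<^sup>2 \<le> 4 * (L * t)\<^sup>2"
      using 5 zero_le_power2[of A] zero_le_power2[of "L * t"] by linarith
    then have "s\<^sup>2 \<le> (2 * (L * t))\<^sup>2" by (simp add: power2_eq_square)
    then have "s \<le> 2 * (L * t)" using L k by (intro power2_le_imp_le[of s]) auto
    moreover have "A\<^sup>2 \<le> (L * t)\<^sup>2" using 5 zero_le_power2[of s] by linarith
    then have "A \<le> L * t" using L k by (intro power2_le_imp_le[of A]) auto
    moreover have "0 \<le> L * t" using L k by simp
    ultimately show ?thesis using k by (simp add: algebra_simps t_def[symmetric])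
  qed
  then show ?thesis
    using L by (intro exI[of _ "2 * L + 1"] conjI allI impI) auto
qed

text \<open>Maximality of the weighted \<open>s\<close> says that \<open>s\<close> lies below an
  explicit function \<open>Q\<close> with equality at \<open>z\<close>. As \<open>Q\<close> has
  continuous second derivatives along the axes, \<open>bochner_touching\<close> applies with it as
  barrier, and \<open>bernstein_algebra\<close> turns the result into a scalar inequality. It
  remains to estimate the derivatives of the cutoff. The powers in \<open>A\<close> and
  \<open>B\<close> are written with \<open>exp\<close> and \<open>ln\<close> so that the chain rule
  gives their derivatives.\<close>

lemma bernstein_at_max:
  fixes z x0 :: "real^'n::finite" and l :: "real^'n \<Rightarrow> real"
    and l1 :: "'n \<Rightarrow> real^'n \<Rightarrow> real" and l2 :: "'n \<Rightarrow> 'n \<Rightarrow> real^'n \<Rightarrow> real"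
    and k m p q M R \<sigma> :: real
  defines "\<phi> \<equiv> \<lambda>x. R\<^sup>2 - (norm (x - x0))\<^sup>2"
    and "s \<equiv> \<lambda>x. \<Sum>i\<in>UNIV. (l1 i x)\<^sup>2"
    and "A \<equiv> \<lambda>x. exp ((p - 1) * l x)"
  defines "B \<equiv> \<lambda>x. M * exp ((q - 1) * l x + q / 2 * ln (s x))"
  assumes U: "open U" "z \<in> U" "U \<subseteq> ball x0 R"
    and l: "\<And>i x. x \<in> U \<Longrightarrow> has_pd l i (l1 i x) x" "continuous_on U l"
    and l1: "\<And>i j x. x \<in> U \<Longrightarrow> has_pd (l1 j) i (l2 i j x) x" "\<And>i. continuous_on U (l1 i)"
    and l2: "\<And>i j. continuous_on U (l2 i j)"
    and spos: "\<And>x. x \<in> U \<Longrightarrow> s x > 0"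
    and eq: "\<And>x. x \<in> U \<Longrightarrow> (\<Sum>i\<in>UNIV. l2 i i x) = - (s x + A x + B x)"
    and max: "\<And>x. x \<in> U \<Longrightarrow>
      s x * exp (\<sigma> * l x + m * ln (\<phi> x)) \<le> s z * exp (\<sigma> * l z + m * ln (\<phi> z))"
    and nonneg: "0 \<le> M" "0 \<le> \<sigma>" "0 \<le> m" "0 \<le> q"
  shows "\<exists>b. b\<^sup>2 \<le> 4 * (R / \<phi> z)\<^sup>2 * s z \<and>
    (s z * (1 - k) + A z + B z)\<^sup>2 / real CARD('n) + (k + 1) * \<sigma> * (s z)\<^sup>2 - k\<^sup>2 * (s z)\<^sup>2
      - (p - 1) * A z * s z - (q - 1) * B z * s z + q / 2 * \<sigma> * B z * s z
      - \<sigma>\<^sup>2 * (s z)\<^sup>2 / 2 - \<sigma> * s z * (s z + A z + B z) / 2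
    \<le> ((\<sigma> + \<bar>k + 1\<bar> + q / 2) * m + 2 * m\<^sup>2 + m * (real CARD('n) + 2))
        * (s z * \<bar>b\<bar> + B z * \<bar>b\<bar> + (R / \<phi> z)\<^sup>2 * s z)"
proof -
  have \<phi>: "\<phi> x > 0" if "x \<in> U" for x
  proof -
    have "norm (x - x0) < R" using that U by (auto simp: dist_norm norm_minus_commute)
    then have "(norm (x - x0))\<^sup>2 < R\<^sup>2" by (intro power_strict_mono) auto
    then show ?thesis by (simp add: \<phi>_def)
  qed
  define s1 where "s1 i x = 2 * (\<Sum>j\<in>UNIV. l1 j x * l2 i j x)" for i x
  define g where "g x = - (s x + A x + B x)" for x
  define g1 where "g1 i x = - (s1 i x + (p - 1) * A x * l1 i x + (q - 1) * B x * l1 i x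
      + q / 2 * B x * s1 i x / s x)" for i x
  \<comment> \<open>\<open>P\<close> and \<open>L\<close> are the first and the pure second partial
    derivatives of \<open>ln (\<phi> x)\<close>.\<close>
  define P where "P i x = - 2 * ((x $ i - x0 $ i) * inverse (\<phi> x))" for i x
  define L where "L i x = - 2 * inverse (\<phi> x) - (P i x)\<^sup>2" for i x
  define \<psi> where "\<psi> x = \<sigma> * l x + m * ln (\<phi> x)" for x
  define Q where "Q x = s z * exp (\<psi> z - \<psi> x)" for x
  define Q1 where "Q1 i x = - (\<sigma> * l1 i x + m * P i x) * Q x" for i x
  define Q2 where "Q2 i x = ((\<sigma> * l1 i x + m * P i x)\<^sup>2 - (\<sigma> * l2 i i x + m * L i x)) * Q x" for i x
  have s_pd: "has_pd s i (s1 i x) x" if "x \<in> U" for i x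
  proof -
    have "has_pd s i (\<Sum>j\<in>UNIV. l2 i j x * l1 j x + l2 i j x * l1 j x) x"
      unfolding s_def power2_eq_square by (intro has_pd_sum has_pd_mult l1 that)
    then show ?thesis by (simp add: s1_def sum_distrib_left mult.commute)
  qed
  have A_pd: "has_pd A i (A x * ((p - 1) * l1 i x)) x" if "x \<in> U" for i x
    unfolding A_def using that by (intro has_pd_chain[where \<phi> = exp] has_pd_cmult l DERIV_exp)
  have ln_s: "has_pd (\<lambda>x. ln (s x)) i (1 / s x * s1 i x) x" if "x \<in> U" for i x
    using that spos by (intro has_pd_chain[where \<phi> = ln] s_pd DERIV_ln_divide)
  have B_pd: "has_pd B i (M * (exp ((q - 1) * l x + q / 2 * ln (s x))
      * ((q - 1) * l1 i x + q / 2 * (1 / s x * s1 i x)))) x" if "x \<in> U" for i x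
    unfolding B_def using that
    by (intro has_pd_cmult[where c = M] has_pd_chain[where \<phi> = exp] has_pd_add has_pd_cmult l ln_s DERIV_exp)
  have g_pd: "has_pd g i (g1 i x) x" if "x \<in> U" for i x
  proof -
    have "has_pd (\<lambda>x. - 1 * (s x + A x + B x)) i (- 1 * (s1 i x + A x * ((p - 1) * l1 i x)
      + M * (exp ((q - 1) * l x + q / 2 * ln (s x)) * ((q - 1) * l1 i x + q / 2 * (1 / s x * s1 i x))))) x"
      using that by (intro has_pd_cmult has_pd_add s_pd A_pd B_pd)
    then show ?thesis unfolding g_def g1_def B_def by (simp add: algebra_simps)
  qed
  have \<phi>_pd: "has_pd \<phi> i (0 - 2 * (x $ i - x0 $ i)) x" for i x
    unfolding \<phi>_def by (intro has_pd_diff has_pd_const has_pd_dist_sq)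
  have ln_\<phi>: "has_pd (\<lambda>x. ln (\<phi> x)) i (P i x) x" if "x \<in> U" for i x
    using has_pd_chain[OF \<phi>_pd DERIV_ln_divide, of x i] \<phi>[OF that]
    by (simp add: P_def divide_inverse algebra_simps)
  have P_pd: "has_pd (P i) i (L i x) x" if "x \<in> U" for i x
  proof -
    have "has_pd (\<lambda>x. inverse (\<phi> x)) i (- (inverse (\<phi> x) ^ Suc (Suc 0)) * (0 - 2 * (x $ i - x0 $ i))) x"
      using \<phi>[OF that] by (intro has_pd_chain[where \<phi> = inverse] \<phi>_pd DERIV_inverse) auto
    moreover have "has_pd (\<lambda>x. x $ i - x0 $ i) i 1 x" using has_pd_coord[of i x0 i x] by simp
    ultimately have "has_pd (\<lambda>x. - 2 * ((x $ i - x0 $ i) * inverse (\<phi> x))) i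
        (- 2 * (1 * inverse (\<phi> x) + - (inverse (\<phi> x) ^ Suc (Suc 0)) * (0 - 2 * (x $ i - x0 $ i)) * (x $ i - x0 $ i))) x"
      by (intro has_pd_cmult has_pd_mult)
    then show ?thesis
      unfolding P_def[abs_def] L_def by (simp add: power2_eq_square algebra_simps)
  qed
  have \<psi>_pd: "has_pd \<psi> i (\<sigma> * l1 i x + m * P i x) x" if "x \<in> U" for i x
    unfolding \<psi>_def[abs_def] using that by (intro has_pd_add has_pd_cmult l ln_\<phi>)
  have Q_pd: "has_pd Q i (Q1 i x) x" if "x \<in> U" for i x
  proof -
    have "has_pd (\<lambda>x. s z * exp (\<psi> z - \<psi> x)) i
        (s z * (exp (\<psi> z - \<psi> x) * (0 - (\<sigma> * l1 i x + m * P i x)))) x"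
      using that by (intro has_pd_cmult has_pd_chain[where \<phi> = exp] has_pd_diff has_pd_const \<psi>_pd DERIV_exp)
    then show ?thesis unfolding Q1_def Q_def[abs_def] by (simp add: algebra_simps)
  qed
  have Q1_pd: "has_pd (Q1 i) i (Q2 i x) x" if "x \<in> U" for i x
  proof -
    have "has_pd (\<lambda>x. - 1 * (\<sigma> * l1 i x + m * P i x) * Q x) i
        (- 1 * (\<sigma> * l2 i i x + m * L i x) * Q x + Q1 i x * (- 1 * (\<sigma> * l1 i x + m * P i x))) x"
      using that by (intro has_pd_mult[OF has_pd_cmult] has_pd_add has_pd_cmult l1 P_pd Q_pd)
    then show ?thesis
      unfolding Q1_def[abs_def] Q2_def by (simp add: power2_eq_square algebra_simps)
  qed
  have cs: "continuous_on U s"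
    unfolding s_def by (intro continuous_on_sum continuous_on_power l1(2))
  have cs1: "continuous_on U (s1 i)" for i
    unfolding s1_def[abs_def]
    by (intro continuous_on_mult continuous_on_const continuous_on_sum l1(2) l2)
  have cA: "continuous_on U A"
    unfolding A_def by (intro continuous_on_exp continuous_on_mult continuous_on_const l(2))
  have cB: "continuous_on U B"
    unfolding B_def using spos
    by (intro continuous_on_exp continuous_on_add continuous_on_mult continuous_on_const l(2)
        continuous_on_ln cs) fastforce
  have cg1: "continuous_on U (g1 i)" for i
    unfolding g1_def[abs_def] using spos
    by (intro continuous_on_minus continuous_on_add continuous_on_mult continuous_on_divide
        continuous_on_const l1(2) cs cs1 cA cB) fastforce
  have c\<phi>: "continuous_on U \<phi>" unfolding \<phi>_def by (intro continuous_intros)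
  have cinv: "continuous_on U (\<lambda>x. inverse (\<phi> x))"
    using \<phi> by (intro continuous_on_inverse c\<phi>) fastforce
  have cP: "continuous_on U (P i)" for i
    unfolding P_def[abs_def] by (intro continuous_on_mult continuous_on_const cinv continuous_intros)
  have cQ: "continuous_on U Q"
    unfolding Q_def[abs_def] \<psi>_def[abs_def] using \<phi>
    by (intro continuous_on_mult continuous_on_const continuous_on_exp continuous_on_diff
        continuous_on_add l(2) continuous_on_ln c\<phi>) fastforce
  have cQ2: "continuous_on U (Q2 i)" for i
    unfolding Q2_def[abs_def] L_def[abs_def]
    by (intro continuous_on_mult continuous_on_diff continuous_on_add continuous_on_power
        continuous_on_const l1(2) l2 cP cinv cQ)
  have touch: "s x \<le> Q x" if "x \<in> U" for x
  proof -
    have "s x * exp (\<psi> x) \<le> s z * exp (\<psi> z)" using max[OF that] by (simp add: \<psi>_def)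
    then show ?thesis by (simp add: Q_def exp_diff field_simps)
  qed
  have Qz: "Q z = s z" by (simp add: Q_def)
  have bochner: "2 * (\<Sum>i\<in>UNIV. \<Sum>j\<in>UNIV. (l2 i j z)\<^sup>2) + 2 * (\<Sum>i\<in>UNIV. l1 i z * g1 i z)
      \<le> (\<Sum>i\<in>UNIV. Q2 i z)"
  proof (rule bochner_touching[OF U(1,2) l(2,1) l1(2,1) l2])
    show "g x = (\<Sum>i\<in>UNIV. l2 i i x)" if "x \<in> U" for x using eq[OF that] by (simp add: g_def)
    show "(\<Sum>i\<in>UNIV. (l1 i x)\<^sup>2) \<le> Q x" if "x \<in> U" for x using touch[OF that] by (simp add: s_def)
    show "(\<Sum>i\<in>UNIV. (l1 i z)\<^sup>2) = Q z" using Qz by (simp add: s_def)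
  qed (rule g_pd cg1 cQ Q_pd Q1_pd cQ2 | assumption)+
  \<comment> \<open>The difference \<open>s - Q\<close> has its maximum 0 at \<open>z\<close>, so
    the first derivatives agree there.\<close>
  have first: "s1 i z = - (\<sigma> * l1 i z + m * P i z) * s z" for i
  proof -
    have "has_pd (\<lambda>x. s x - Q x) i (s1 i z - Q1 i z) z"
      using U by (intro has_pd_diff s_pd Q_pd)
    from has_pd_zero_at_max[OF U(1,2) this] touch Qz show ?thesis
      by (simp add: Q1_def)
  qed
  define b where "b = (\<Sum>i\<in>UNIV. l1 i z * P i z)"
  define \<tau> where "\<tau> = R / \<phi> z"
  have sP: "(\<Sum>i\<in>UNIV. (P i z)\<^sup>2) \<le> 4 * \<tau>\<^sup>2"
  proof -
    have "(\<Sum>i\<in>UNIV. (P i z)\<^sup>2) = 4 * (inverse (\<phi> z))\<^sup>2 * (norm (z - x0))\<^sup>2"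
      unfolding P_def power2_norm_eq_inner inner_vec_def
      by (simp add: sum_distrib_left power2_eq_square algebra_simps)
    also have "\<dots> \<le> 4 * (inverse (\<phi> z))\<^sup>2 * R\<^sup>2"
      using \<phi>[OF U(2)] by (intro mult_left_mono) (auto simp: \<phi>_def)
    finally show ?thesis by (simp add: \<tau>_def divide_inverse power_mult_distrib power_inverse mult_ac)
  qed
  \<comment> \<open>Besides the bound on \<open>P\<close>, this uses
    \<open>\<phi> z \<le> R\<^sup>2\<close>, which gives
    \<open>inverse (\<phi> z) \<le> \<tau>\<^sup>2\<close>.\<close>
  have sL: "- (\<Sum>i\<in>UNIV. L i z) \<le> (2 * real CARD('n) + 4) * \<tau>\<^sup>2"
  proof -
    have "inverse (\<phi> z) = \<phi> z * (inverse (\<phi> z))\<^sup>2"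
      using \<phi>[OF U(2)] by (simp add: power2_eq_square)
    also have "\<dots> \<le> R\<^sup>2 * (inverse (\<phi> z))\<^sup>2"
      by (intro mult_right_mono) (auto simp: \<phi>_def)
    finally have "inverse (\<phi> z) \<le> \<tau>\<^sup>2"
      by (simp add: \<tau>_def divide_inverse power_mult_distrib power_inverse)
    then have "2 * real CARD('n) * inverse (\<phi> z) \<le> 2 * real CARD('n) * \<tau>\<^sup>2"
      by (intro mult_left_mono) auto
    moreover have "(\<Sum>i\<in>UNIV. L i z) = - (2 * real CARD('n) * inverse (\<phi> z)) - (\<Sum>i\<in>UNIV. (P i z)\<^sup>2)"
      by (simp add: L_def sum_subtractf)
    ultimately show ?thesis using sP unfolding distrib_right by linarith
  qed
  have "b\<^sup>2 \<le> s z * (\<Sum>i\<in>UNIV. (P i z)\<^sup>2)"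
    unfolding b_def s_def by (rule Cauchy_Schwarz_ineq_sum)
  also have "\<dots> \<le> s z * (4 * \<tau>\<^sup>2)"
    using spos[OF U(2)] sP by (intro mult_left_mono) auto
  finally have b: "b\<^sup>2 \<le> 4 * \<tau>\<^sup>2 * s z" by (simp add: mult_ac)
  have Bz: "B z \<ge> 0" using nonneg by (simp add: B_def)
  let ?F = "(s z * (1 - k) + A z + B z)\<^sup>2 / real CARD('n) + (k + 1) * \<sigma> * (s z)\<^sup>2 - k\<^sup>2 * (s z)\<^sup>2
      - (p - 1) * A z * s z - (q - 1) * B z * s z + q / 2 * \<sigma> * B z * s z
      - \<sigma>\<^sup>2 * (s z)\<^sup>2 / 2 - \<sigma> * s z * (s z + A z + B z) / 2"
  have F: "?F \<le> (\<sigma> - (k + 1)) * m * (s z * b) - q / 2 * m * (B z * b)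
      + m\<^sup>2 / 2 * (\<Sum>i\<in>UNIV. (P i z)\<^sup>2) * s z - m / 2 * (\<Sum>i\<in>UNIV. L i z) * s z"
    unfolding b_def
  proof (rule bernstein_algebra[where D = "\<lambda>i j. l2 i j z"])
    show "s z = (\<Sum>i\<in>UNIV. (l1 i z)\<^sup>2)" by (simp add: s_def)
    show "s z > 0" using spos U by simp
    show "2 * (\<Sum>j\<in>UNIV. l1 j z * l2 i j z) = - (\<sigma> * l1 i z + m * P i z) * s z" for i
      using first by (simp add: s1_def)
    show "(\<Sum>i\<in>UNIV. l2 i i z) = - (s z + A z + B z)" using eq U by simp
  qed (use bochner in \<open>simp only: g1_def first Q2_def Qz\<close>)
  have bb: "- (B z * b) \<le> B z * \<bar>b\<bar>" using Bz by (auto simp: abs_if)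
  have 1: "(\<sigma> - (k + 1)) * m * (s z * b) \<le> (\<sigma> + \<bar>k + 1\<bar>) * m * (s z * \<bar>b\<bar>)"
  proof -
    have "(\<sigma> - (k + 1)) * m * (s z * b) \<le> \<bar>(\<sigma> - (k + 1)) * m * (s z * b)\<bar>" by simp
    also have "\<dots> = \<bar>\<sigma> - (k + 1)\<bar> * (m * (s z * \<bar>b\<bar>))"
      using nonneg spos[OF U(2)] by (simp add: abs_mult)
    also have "\<dots> \<le> (\<sigma> + \<bar>k + 1\<bar>) * (m * (s z * \<bar>b\<bar>))"
      using nonneg spos[OF U(2)] by (intro mult_right_mono) auto
    finally show ?thesis by (simp add: mult_ac)
  qed
  have 2: "- (q / 2 * m * (B z * b)) \<le> q / 2 * m * (B z * \<bar>b\<bar>)"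
    using mult_left_mono[OF bb, of "q / 2 * m"] nonneg by simp
  have 3: "m\<^sup>2 / 2 * (\<Sum>i\<in>UNIV. (P i z)\<^sup>2) * s z \<le> 2 * m\<^sup>2 * (\<tau>\<^sup>2 * s z)"
    using mult_left_mono[OF sP, of "m\<^sup>2 / 2 * s z"] spos[OF U(2)] by (simp add: mult_ac)
  have 4: "- (m / 2 * (\<Sum>i\<in>UNIV. L i z) * s z) \<le> m * (real CARD('n) + 2) * (\<tau>\<^sup>2 * s z)"
    using mult_left_mono[OF sL, of "m / 2 * s z"] spos[OF U(2)] nonneg by (simp add: algebra_simps)
  let ?K1 = "(\<sigma> + \<bar>k + 1\<bar>) * m" and ?K2 = "q / 2 * m" and ?K3 = "2 * m\<^sup>2 + m * (real CARD('n) + 2)"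
  let ?x = "s z * \<bar>b\<bar>" and ?y = "B z * \<bar>b\<bar>" and ?w = "\<tau>\<^sup>2 * s z"
  have K: "?K1 \<ge> 0" "?K2 \<ge> 0" "?K3 \<ge> 0" using nonneg by auto
  have xyw: "?x \<ge> 0" "?y \<ge> 0" "?w \<ge> 0" using spos[OF U(2)] Bz by auto
  have "?F \<le> ?K1 * ?x + ?K2 * ?y + ?K3 * ?w"
    using F 1 2 3 4 by (simp add: distrib_right)
  also have "\<dots> \<le> (?K1 + ?K2 + ?K3) * (?x + ?y + ?w)"
  proof -
    have "?K1 * ?x \<le> (?K1 + ?K2 + ?K3) * ?x" "?K2 * ?y \<le> (?K1 + ?K2 + ?K3) * ?y"
      "?K3 * ?w \<le> (?K1 + ?K2 + ?K3) * ?w"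
      using K xyw by (intro mult_right_mono; simp)+
    then show ?thesis unfolding distrib_left by linarith
  qed
  also have "?K1 + ?K2 + ?K3 = (\<sigma> + \<bar>k + 1\<bar> + q / 2) * m + 2 * m\<^sup>2 + m * (real CARD('n) + 2)"
    by (simp add: algebra_simps)
  finally show ?thesis using b unfolding \<tau>_def by (intro exI[of _ b] conjI)
qed

section \<open>The logarithm of a positive solution and the gradient bound on balls\<close>

lemma C1_on_has_pd:
  assumes "C1_on S f" "open S" "x \<in> S"
  shows "has_pd f i (partial_derivative i f x) x"
  using assms by (intro has_pd_partial_derivative)
    (auto simp: C1_on_def differentiable_on_eq_differentiable_at)

lemma norm_gradient_sq: "(norm (gradient u x))\<^sup>2 = (\<Sum>i\<in>UNIV. (partial_derivative i u x)\<^sup>2)"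
  unfolding power2_norm_eq_inner inner_vec_def gradient_def by (simp add: power2_eq_square)

text \<open>Dividing the equation by \<open>u\<close> turns the source terms into
  \<open>u powr (p - 1)\<close> and \<open>M * u powr (q - 1) * s powr (q / 2)\<close>, and the
  Laplacian of \<open>ln u\<close> contributes \<open>- s\<close>. The last fact is restricted to
  \<open>s x > 0\<close> because the power of \<open>s\<close> is expressed through
  \<open>ln\<close>.\<close>

lemma log_solution:
  fixes u :: "real^'n::finite \<Rightarrow> real" and p q M :: real
  defines "l \<equiv> \<lambda>x. ln (u x)"
    and "l1 \<equiv> \<lambda>i x. partial_derivative i u x / u x"
  defines "l2 \<equiv> \<lambda>i j x. partial_derivative i (partial_derivative j u) x / u x - l1 i x * l1 j x"
    and "s \<equiv> \<lambda>x. \<Sum>i\<in>UNIV. (l1 i x)\<^sup>2"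
  assumes sol: "is_solution p q M S u" and S: "open S" and pos: "\<forall>x\<in>S. u x > 0"
  shows "\<And>i x. x \<in> S \<Longrightarrow> has_pd l i (l1 i x) x" "continuous_on S l"
    "\<And>i j x. x \<in> S \<Longrightarrow> has_pd (l1 j) i (l2 i j x) x" "\<And>i. continuous_on S (l1 i)"
    "\<And>i j. continuous_on S (l2 i j)"
    "\<And>x. x \<in> S \<Longrightarrow> (norm (gradient u x))\<^sup>2 = (u x)\<^sup>2 * s x"
    "\<And>x. x \<in> S \<Longrightarrow> s x > 0 \<Longrightarrow> (\<Sum>i\<in>UNIV. l2 i i x)
      = - (s x + exp ((p - 1) * l x) + M * exp ((q - 1) * l x + q / 2 * ln (s x)))"
proof -
  have C1: "C1_on S u" "\<And>i. C1_on S (partial_derivative i u)"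
    using sol by (auto simp: is_solution_def C2_on_def)
  have cu: "continuous_on S u"
    using C1(1) by (simp add: C1_on_def differentiable_imp_continuous_on)
  have cu1: "continuous_on S (partial_derivative i u)" for i
    using C1(1) by (simp add: C1_on_def)
  have cu2: "continuous_on S (partial_derivative i (partial_derivative j u))" for i j
    using C1(2) by (simp add: C1_on_def)
  have nz: "\<forall>x\<in>S. u x \<noteq> 0" using pos by fastforce
  show "has_pd l i (l1 i x) x" if "x \<in> S" for i x
    using has_pd_chain[OF C1_on_has_pd[OF C1(1) S that] DERIV_ln_divide[OF bspec[OF pos that]], of i]
    by (simp add: l_def l1_def)
  show "continuous_on S l" unfolding l_def by (intro continuous_on_ln cu nz)
  show cl1: "continuous_on S (l1 i)" for i
    unfolding l1_def by (intro continuous_on_divide cu1 cu nz)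
  show "continuous_on S (l2 i j)" for i j
    unfolding l2_def by (intro continuous_on_diff continuous_on_divide continuous_on_mult cu2 cu nz cl1)
  show "has_pd (l1 j) i (l2 i j x) x" if x: "x \<in> S" for i j x
  proof -
    have "has_pd (\<lambda>x. partial_derivative j u x / u x) i
      ((partial_derivative i (partial_derivative j u) x * u x
        - partial_derivative j u x * partial_derivative i u x) / (u x * u x)) x"
      using bspec[OF pos x] by (intro has_pd_divide C1_on_has_pd[OF _ S x] C1) simp
    then show ?thesis
      unfolding l1_def l2_def using bspec[OF pos x] by (simp add: field_simps)
  qed
  show ngrad: "(norm (gradient u x))\<^sup>2 = (u x)\<^sup>2 * s x" if "x \<in> S" for x
    unfolding norm_gradient_sq s_def l1_def sum_distrib_left using bspec[OF pos that]
    by (simp add: power_divide)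
  show "(\<Sum>i\<in>UNIV. l2 i i x)
      = - (s x + exp ((p - 1) * l x) + M * exp ((q - 1) * l x + q / 2 * ln (s x)))"
    if x: "x \<in> S" and sx: "s x > 0" for x
  proof -
    have u: "u x > 0" using pos x by simp
    have "norm (gradient u x) = sqrt ((norm (gradient u x))\<^sup>2)" by simp
    also have "\<dots> = u x * sqrt (s x)"
      unfolding ngrad[OF x] using u by (simp add: real_sqrt_mult)
    finally have "norm (gradient u x) powr q = exp (q * (l x + ln (s x) / 2))"
      using u sx by (simp add: powr_def l_def ln_mult ln_sqrt)
    then have "laplacian u x = - (exp ((p - 1) * l x) * u x + M * exp (q * (l x + ln (s x) / 2)))"
      using sol x u by (auto simp: is_solution_def powr_def l_def)
    moreover have "u x = exp (l x)" using u by (simp add: l_def)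
    ultimately have "laplacian u x / u x
        = - (exp ((p - 1) * l x) + M * exp ((q - 1) * l x + q / 2 * ln (s x)))"
      by (simp add: field_simps exp_add[symmetric] exp_diff[symmetric])
    moreover have "(\<Sum>i\<in>UNIV. l2 i i x) = laplacian u x / u x - s x"
      unfolding l2_def s_def laplacian_def
      by (simp add: sum_subtractf sum_divide_distrib power2_eq_square)
    ultimately show ?thesis by simp
  qed
qed

text \<open>The cutoff vanishes on the sphere, so the weighted quantity \<open>Z\<close> has an
  interior maximum point unless the gradient vanishes at the centre. The bounds on \<open>s\<close>
  and \<open>A\<close> there control the maximum, hence the value at the centre. Both constants are
  fixed before \<open>S\<close>, \<open>u\<close>, \<open>M\<close> and the ball.\<close>

lemma gradient_bound_ball:
  fixes p q :: real
  assumes N: "CARD('n::finite) \<ge> 2"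
    and p: "1 < p" "p < (real CARD('n) + 3) / (real CARD('n) - 1)"
    and q: "1 < q" "q < (real CARD('n) + 2) / real CARD('n)"
  shows "\<exists>\<sigma>>0. \<exists>C>0. \<forall>S (u :: real^'n \<Rightarrow> real) M x0 R.
    open S \<longrightarrow> cball x0 R \<subseteq> S \<longrightarrow> 0 < R \<longrightarrow> 0 \<le> M \<longrightarrow> is_solution p q M S u \<longrightarrow> (\<forall>x\<in>S. u x > 0) \<longrightarrow>
    (norm (gradient u x0))\<^sup>2 / (u x0)\<^sup>2 * u x0 powr \<sigma> \<le> C * R powr (- (2 + 2 * \<sigma> / (p - 1)))"
proof -
  define k where "k = - 2 / (real CARD('n) - 1)"
  obtain \<sigma> c where \<sigma>: "\<sigma> > 0" and c: "c > 0"
    and form: "\<And>s A B. s \<ge> 0 \<Longrightarrow> A \<ge> 0 \<Longrightarrow> B \<ge> 0 \<Longrightarrow>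
      c * (s\<^sup>2 + A\<^sup>2 + B\<^sup>2) \<le> (s * (1 - k) + A + B)\<^sup>2 / real CARD('n)
      + (k + 1) * \<sigma> * s\<^sup>2 - k\<^sup>2 * s\<^sup>2
      - (p - 1) * A * s - (q - 1) * B * s + q / 2 * \<sigma> * B * s
      - \<sigma>\<^sup>2 * s\<^sup>2 / 2 - \<sigma> * s * (s + A + B) / 2"
    using form_coercive[of "real CARD('n)" p q] N p q unfolding k_def by auto
  \<comment> \<open>With this exponent the powers of the cutoff cancel exactly when
    \<open>s * u powr \<sigma>\<close> is bounded by a power of
    \<open>\<tau>\<^sup>2\<close>.\<close>
  define m where "m = 2 + 2 * \<sigma> / (p - 1)"
  have m: "m > 0" using \<sigma> p by (simp add: m_def add_pos_pos)
  define K where "K = (\<sigma> + \<bar>k + 1\<bar> + q / 2) * m + 2 * m\<^sup>2 + m * (real CARD('n) + 2)"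
  have "K \<ge> 0" using \<sigma> m q by (simp add: K_def)
  then obtain C where C: "C > 0" and absorb: "\<And>s A B \<tau> b. s \<ge> 0 \<Longrightarrow> A \<ge> 0 \<Longrightarrow> B \<ge> 0 \<Longrightarrow>
     b\<^sup>2 \<le> 4 * \<tau>\<^sup>2 * s \<Longrightarrow> c * (s\<^sup>2 + A\<^sup>2 + B\<^sup>2) \<le> K * (s * \<bar>b\<bar> + B * \<bar>b\<bar> + \<tau>\<^sup>2 * s) \<Longrightarrow>
     s \<le> C * \<tau>\<^sup>2 \<and> A \<le> C * \<tau>\<^sup>2"
    using absorb_errors[OF c, of K] by blast
  have main: "(norm (gradient u x0))\<^sup>2 / (u x0)\<^sup>2 * u x0 powr \<sigma> \<le> C powr (m / 2) * R powr (- m)"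
    if S: "open S" "cball x0 R \<subseteq> S" and R: "0 < R" and M: "0 \<le> M"
      and sol: "is_solution p q M S u" and pos: "\<forall>x\<in>S. u x > 0"
    for S M x0 R and u :: "real^'n \<Rightarrow> real"
  proof -
    define l where "l x = ln (u x)" for x
    define l1 where "l1 i x = partial_derivative i u x / u x" for i x
    define l2 where "l2 i j x = partial_derivative i (partial_derivative j u) x / u x - l1 i x * l1 j x" for i j x
    define s where "s x = (\<Sum>i\<in>UNIV. (l1 i x)\<^sup>2)" for x
    define \<phi> where "\<phi> x = R\<^sup>2 - (norm (x - x0))\<^sup>2" for x
    note log = log_solution[OF sol S(1) pos, folded l_def l1_def, folded l2_def s_def]
    define Z where "Z x = s x * exp (\<sigma> * l x) * \<phi> x powr m" for x
    have x0: "x0 \<in> cball x0 R" "x0 \<in> S" using R S by auto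
    have \<phi>_nonneg: "\<phi> x \<ge> 0" if "x \<in> cball x0 R" for x
      using that R by (auto simp: \<phi>_def dist_norm norm_minus_commute power_mono)
    have s_nonneg: "s x \<ge> 0" for x by (simp add: s_def sum_nonneg)
    have "(norm (gradient u x0))\<^sup>2 / (u x0)\<^sup>2 = s x0"
      using log(6)[OF x0(2)] bspec[OF pos x0(2)] by simp
    moreover have "u x0 powr \<sigma> = exp (\<sigma> * l x0)"
      using bspec[OF pos x0(2)] by (simp add: powr_def l_def)
    moreover have "s x0 * exp (\<sigma> * l x0) \<le> C powr (m / 2) * R powr (- m)"
    proof (cases "s x0 = 0")
      case True
      then show ?thesis by simp
    next
      case False
      have cs: "continuous_on S s"
        unfolding s_def[abs_def] by (intro continuous_on_sum continuous_on_power log(4))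
      have cZ: "continuous_on (cball x0 R) Z"
        unfolding Z_def[abs_def]
      proof (intro continuous_on_mult continuous_on_exp continuous_on_const continuous_on_powr')
        show "continuous_on (cball x0 R) s" "continuous_on (cball x0 R) l"
          using cs log(2) S(2) continuous_on_subset by blast+
        show "continuous_on (cball x0 R) \<phi>"
          unfolding \<phi>_def[abs_def] by (intro continuous_intros)
      qed (use \<phi>_nonneg m in auto)
      obtain z where z: "z \<in> cball x0 R" "\<And>x. x \<in> cball x0 R \<Longrightarrow> Z x \<le> Z z"
        using continuous_attains_sup[OF compact_cball _ cZ] x0(1) by blast
      \<comment> \<open>Positivity at the centre passes to the maximum, so neither \<open>s\<close>
        nor the cutoff vanishes at \<open>z\<close>.\<close>
      have "Z x0 > 0" using False s_nonneg[of x0] R by (simp add: Z_def \<phi>_def less_le)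
      then have "Z z > 0" using z(2)[OF x0(1)] by linarith
      then have "s z \<noteq> 0" "\<phi> z \<noteq> 0" by (auto simp: Z_def)
      then have sz: "s z > 0" and \<phi>z: "\<phi> z > 0" using s_nonneg \<phi>_nonneg[OF z(1)] by (auto simp: less_le)
      \<comment> \<open>The function \<open>ln (s x)\<close> occurs in \<open>B\<close>, so the
        argument is confined to the open set where \<open>s\<close> is positive.\<close>
      define U where "U = ball x0 R \<inter> {x \<in> S. s x \<in> {0<..}}"
      have "open {x \<in> S. s x \<in> {0<..}}"
        using cs S(1) by (intro continuous_open_preimage[unfolded vimage_def Int_def mem_Collect_eq]) auto
      then have U: "open U" "U \<subseteq> ball x0 R" by (auto simp: U_def)
      have "norm (z - x0) < R"
        using \<phi>z R by (intro power2_less_imp_less[of _ R]) (auto simp: \<phi>_def)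
      then have zU: "z \<in> U" using sz z(1) S(2) by (auto simp: U_def dist_norm norm_minus_commute)
      have US: "x \<in> S" if "x \<in> U" for x using that by (auto simp: U_def)
      have cU: "continuous_on U f" if "continuous_on S f" for f :: "real^'n \<Rightarrow> real"
        using continuous_on_subset[OF that] US by blast
      have \<phi>U: "\<phi> x > 0" if "x \<in> U" for x
      proof -
        have "norm (x - x0) < R" using that by (auto simp: U_def dist_norm norm_minus_commute)
        then show ?thesis by (simp add: \<phi>_def power_strict_mono)
      qed
      define A where "A = exp ((p - 1) * l z)"
      define B where "B = M * exp ((q - 1) * l z + q / 2 * ln (s z))"
      define \<tau> where "\<tau> = R / \<phi> z"
      have "\<exists>b. b\<^sup>2 \<le> 4 * \<tau>\<^sup>2 * s z \<and> (s z * (1 - k) + A + B)\<^sup>2 / real CARD('n)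
          + (k + 1) * \<sigma> * (s z)\<^sup>2 - k\<^sup>2 * (s z)\<^sup>2
          - (p - 1) * A * s z - (q - 1) * B * s z + q / 2 * \<sigma> * B * s z
          - \<sigma>\<^sup>2 * (s z)\<^sup>2 / 2 - \<sigma> * s z * (s z + A + B) / 2
        \<le> K * (s z * \<bar>b\<bar> + B * \<bar>b\<bar> + \<tau>\<^sup>2 * s z)"
        unfolding A_def B_def K_def \<tau>_def \<phi>_def s_def
      proof (rule bernstein_at_max[OF U(1) zU U(2), where ?l2.0 = l2])
        fix x assume x: "x \<in> U"
        show "has_pd l i (l1 i x) x" for i using log(1) US[OF x] by blast
        show "has_pd (l1 j) i (l2 i j x) x" for i j using log(3) US[OF x] by blast
        show sx: "0 < (\<Sum>i\<in>UNIV. (l1 i x)\<^sup>2)" using x by (simp add: U_def s_def)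
        show "(\<Sum>i\<in>UNIV. l2 i i x) = - ((\<Sum>i\<in>UNIV. (l1 i x)\<^sup>2) + exp ((p - 1) * l x)
            + M * exp ((q - 1) * l x + q / 2 * ln (\<Sum>i\<in>UNIV. (l1 i x)\<^sup>2)))"
          using log(7)[OF US[OF x]] sx by (simp add: s_def)
        have "Z x \<le> Z z" using z(2) x by (auto simp: U_def)
        then have "s x * exp (\<sigma> * l x + m * ln (\<phi> x)) \<le> s z * exp (\<sigma> * l z + m * ln (\<phi> z))"
          using \<phi>U[OF x] \<phi>z by (simp add: Z_def powr_def exp_add mult.assoc)
        then show "(\<Sum>i\<in>UNIV. (l1 i x)\<^sup>2) * exp (\<sigma> * l x + m * ln (R\<^sup>2 - (norm (x - x0))\<^sup>2))
            \<le> (\<Sum>i\<in>UNIV. (l1 i z)\<^sup>2) * exp (\<sigma> * l z + m * ln (R\<^sup>2 - (norm (z - x0))\<^sup>2))"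
          by (simp add: s_def \<phi>_def)
      next
        show "continuous_on U l" "\<And>i. continuous_on U (l1 i)" "\<And>i j. continuous_on U (l2 i j)"
          using log(2,4,5) by (auto intro: cU)
      qed (use M \<sigma> m q in auto)
      then obtain b where b: "b\<^sup>2 \<le> 4 * \<tau>\<^sup>2 * s z"
        "c * ((s z)\<^sup>2 + A\<^sup>2 + B\<^sup>2) \<le> K * (s z * \<bar>b\<bar> + B * \<bar>b\<bar> + \<tau>\<^sup>2 * s z)"
        using form[of "s z" A B] sz M by (auto simp: A_def B_def intro: order_trans)
      then have sA: "s z \<le> C * \<tau>\<^sup>2" "A \<le> C * \<tau>\<^sup>2"
        using absorb[of "s z" A B b \<tau>] sz M by (auto simp: A_def B_def)
      have \<tau>: "\<tau> > 0" using R \<phi>z by (simp add: \<tau>_def)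
      \<comment> \<open>The weight \<open>u powr \<sigma>\<close> is a power of \<open>A\<close>, so
        the bound on \<open>A\<close> controls it as well.\<close>
      have "exp (\<sigma> * l z) = A powr (\<sigma> / (p - 1))"
        using p by (simp add: A_def powr_def)
      also have "\<dots> \<le> (C * \<tau>\<^sup>2) powr (\<sigma> / (p - 1))"
        using sA \<sigma> p by (intro powr_mono2) (auto simp: A_def)
      finally have "s z * exp (\<sigma> * l z) \<le> (C * \<tau>\<^sup>2) powr 1 * (C * \<tau>\<^sup>2) powr (\<sigma> / (p - 1))"
        using sA C sz by (intro mult_mono) auto
      also have "\<dots> = (C * \<tau>\<^sup>2) powr (m / 2)"
      proof -
        have "m / 2 = 1 + \<sigma> / (p - 1)" using p by (simp add: m_def field_simps)
        then show ?thesis by (simp only: powr_add)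
      qed
      also have "\<dots> = C powr (m / 2) * \<tau> powr m"
        using C \<tau> by (simp add: powr_mult powr_powr flip: powr_numeral)
      finally have "Z z \<le> C powr (m / 2) * \<tau> powr m * \<phi> z powr m"
        unfolding Z_def using \<phi>z by (intro mult_right_mono) auto
      also have "\<dots> = C powr (m / 2) * R powr m"
        using R \<phi>z by (simp add: \<tau>_def powr_divide)
      finally have "Z x0 \<le> C powr (m / 2) * R powr m" using z(2)[OF x0(1)] by linarith
      \<comment> \<open>At the centre the cutoff equals \<open>R\<^sup>2\<close>; dividing by
        \<open>R powr (2 * m)\<close> turns \<open>R powr m\<close> into
        \<open>R powr (- m)\<close>.\<close>
      moreover have "Z x0 = s x0 * exp (\<sigma> * l x0) * (R powr m * R powr m)"
        using R by (simp add: Z_def \<phi>_def power2_eq_square powr_mult)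
      moreover have "R powr m > 0" using R by simp
      ultimately show ?thesis
        using R by (simp add: powr_minus field_simps)
    qed
    ultimately show ?thesis by simp
  qed
  show ?thesis
    using \<sigma> C main unfolding m_def
    by (intro exI[of _ \<sigma>] conjI exI[of _ "C powr ((2 + 2 * \<sigma> / (p - 1)) / 2)"] allI impI) auto
qed

subsection \<open>Strong maximum principle\<close>

text \<open>A zero \<open>y\<close> nearest to \<open>x1\<close> is compared with the Hopf barrier
  \<open>E\<close> on an annulus around \<open>x1\<close>. As \<open>u\<close> is nonnegative on the
  whole space, the comparison function \<open>f\<close> stays below its annulus maximum beyond the
  outer sphere too. The maximum is thus interior to the complement of the inner ball, where the
  barrier is strictly subharmonic.\<close>

lemma superharmonic_positive:
  fixes u :: "real^'n::finite \<Rightarrow> real"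
  assumes C2: "C2_on UNIV u" and super: "\<And>x. laplacian u x \<le> 0"
    and nonneg: "\<And>x. u x \<ge> 0" and nontrivial: "u x1 \<noteq> 0"
  shows "u x > 0"
proof (rule ccontr)
  assume "\<not> u x > 0"
  have C1: "C1_on UNIV u" "\<And>i. C1_on UNIV (partial_derivative i u)"
    using C2 by (auto simp: C2_on_def)
  have cu: "continuous_on T u" for T
    using C1(1) differentiable_imp_continuous_on continuous_on_subset
    unfolding C1_on_def by blast
  define Z where "Z = u -` {0}"
  have "closed Z" unfolding Z_def by (intro closed_vimage cu) simp
  moreover have "x \<in> Z" using \<open>\<not> u x > 0\<close> nonneg[of x] by (simp add: Z_def)
  ultimately obtain y where y: "y \<in> Z" "\<And>w. w \<in> Z \<Longrightarrow> dist x1 y \<le> dist x1 w"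
    using distance_attains_inf[of Z x1] by blast
  define r where "r = dist x1 y"
  have r: "r > 0" using y(1) nontrivial by (auto simp: r_def Z_def)
  obtain w0 where w0: "w0 \<in> cball x1 (r / 2)" "\<And>w. w \<in> cball x1 (r / 2) \<Longrightarrow> u w0 \<le> u w"
    using continuous_attains_inf[OF compact_cball _ cu, of x1 "r / 2"] r by (auto simp: not_less)
  have "w0 \<notin> Z"
  proof
    assume "w0 \<in> Z"
    then show False using y(2)[of w0] w0(1) r unfolding r_def mem_cball by linarith
  qed
  then have uw0: "u w0 > 0" using nonneg[of w0] by (simp add: Z_def less_le)
  \<comment> \<open>Chosen so that at distance at least \<open>r / 2\<close> the quantity
    \<open>2 * \<alpha> * (norm (x - x1))\<^sup>2\<close> is at least
    \<open>real CARD('n) + 1 / 2\<close>, which makes the Laplacian of \<open>E\<close> positive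
    there.\<close>
  define \<alpha> where "\<alpha> = (2 * real CARD('n) + 1) / r\<^sup>2"
  have \<alpha>: "\<alpha> > 0" using r by (simp add: \<alpha>_def add_nonneg_pos)
  define E where "E x = exp (- \<alpha> * (norm (x - x1))\<^sup>2)" for x
  \<comment> \<open>On the inner ball \<open>u\<close> is at least \<open>2 * \<epsilon>\<close>
    while the barrier is at most \<epsilon>, so \<open>f\<close> is negative there and the maximum
    point cannot lie on the inner sphere.\<close>
  define \<epsilon> where "\<epsilon> = u w0 / 2"
  define f where "f x = \<epsilon> * (E x - exp (- \<alpha> * r\<^sup>2)) - u x" for x
  define f1 where "f1 i x = \<epsilon> * (E x * (- \<alpha> * (2 * (x $ i - x1 $ i))) - 0) - partial_derivative i u x" for i x
  define f2 where "f2 i x = \<epsilon> * (E x * (- \<alpha> * (2 * (x $ i - x1 $ i))) * (- \<alpha> * (2 * (x $ i - x1 $ i)))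
      + - \<alpha> * (2 * 1) * E x - 0) - partial_derivative i (partial_derivative i u) x" for i x
  have E_pd: "has_pd E i (E x * (- \<alpha> * (2 * (x $ i - x1 $ i)))) x" for i x
    unfolding E_def by (intro has_pd_chain[where \<phi> = exp] has_pd_cmult has_pd_dist_sq DERIV_exp)
  have f_pd: "has_pd f i (f1 i x) x" for i x
    unfolding f_def[abs_def] f1_def
    by (intro has_pd_diff has_pd_cmult E_pd has_pd_const C1_on_has_pd[OF C1(1)]) auto
  have f1_pd: "has_pd (f1 i) i (f2 i x) x" for i x
  proof -
    have coord: "has_pd (\<lambda>x. x $ i - x1 $ i) i 1 x"
      using has_pd_coord[of i x1 i x] by simp
    show ?thesis
      unfolding f1_def[abs_def] f2_def
      by (intro has_pd_diff has_pd_cmult has_pd_mult E_pd coord has_pd_const C1_on_has_pd[OF C1(2)]) auto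
  qed
  define K where "K = cball x1 r - ball x1 (r / 2)"
  have "compact K" unfolding K_def by (intro compact_diff) auto
  moreover have yK: "y \<in> K" using r by (simp add: K_def r_def)
  moreover have "continuous_on K f"
    unfolding f_def[abs_def] E_def by (intro continuous_on_diff cu continuous_intros)
  ultimately obtain z where z: "z \<in> K" "\<And>x. x \<in> K \<Longrightarrow> f x \<le> f z"
    using continuous_attains_sup[of K f] by blast
  have "f y = 0"
    using y(1) by (simp add: f_def E_def Z_def r_def dist_norm norm_minus_commute)
  then have fz: "f z \<ge> 0" using z(2)[OF yK] by simp
  have "dist x1 z > r / 2"
  proof (rule ccontr)
    assume "\<not> dist x1 z > r / 2"
    then have "z \<in> cball x1 (r / 2)" by simp
    then have "u w0 \<le> u z" using w0 by simp
    moreover have "E z \<le> 1" "exp (- \<alpha> * r\<^sup>2) > 0" using \<alpha> by (auto simp: E_def)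
    then have "\<epsilon> * (E z - exp (- \<alpha> * r\<^sup>2)) \<le> \<epsilon> * 1"
      using uw0 by (intro mult_left_mono) (linarith, simp add: \<epsilon>_def)
    moreover have "\<epsilon> * 1 = u w0 / 2" by (simp add: \<epsilon>_def)
    ultimately show False using fz uw0 unfolding f_def by linarith
  qed
  have le: "f x \<le> f z" if "x \<in> - cball x1 (r / 2)" for x
  proof (cases "dist x1 x \<le> r")
    case True
    then show ?thesis using z(2)[of x] that by (simp add: K_def)
  next
    case False
    then have "r\<^sup>2 \<le> (norm (x - x1))\<^sup>2"
      using r by (intro power_mono) (auto simp: dist_norm norm_minus_commute)
    then have "\<epsilon> * (E x - exp (- \<alpha> * r\<^sup>2)) \<le> 0"
      using uw0 \<alpha> by (intro mult_nonneg_nonpos) (auto simp: E_def \<epsilon>_def)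
    then show ?thesis using fz nonneg[of x] by (simp add: f_def)
  qed
  have "f2 i z \<le> 0" for i
    using \<open>dist x1 z > r / 2\<close>
    by (intro second_pd_nonpos_at_max[of "- cball x1 (r / 2)" z f i "f1 i"] f_pd f1_pd le) auto
  then have "(\<Sum>i\<in>UNIV. f2 i z) \<le> 0" by (simp add: sum_nonpos)
  moreover have "(\<Sum>i\<in>UNIV. f2 i z)
      = \<epsilon> * E z * (2 * \<alpha>) * (2 * \<alpha> * (norm (z - x1))\<^sup>2 - real CARD('n)) - laplacian u z"
    unfolding f2_def laplacian_def power2_norm_eq_inner inner_vec_def
    by (simp add: sum_subtractf sum.distrib sum_distrib_left power2_eq_square algebra_simps)
  moreover have "\<epsilon> * E z * (2 * \<alpha>) * (2 * \<alpha> * (norm (z - x1))\<^sup>2 - real CARD('n)) > 0"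
  proof -
    have "(r / 2)\<^sup>2 \<le> (norm (z - x1))\<^sup>2"
      using \<open>dist x1 z > r / 2\<close> r by (intro power_mono) (auto simp: dist_norm norm_minus_commute)
    then have "2 * \<alpha> * (r / 2)\<^sup>2 \<le> 2 * \<alpha> * (norm (z - x1))\<^sup>2"
      using \<alpha> by (intro mult_left_mono) auto
    moreover have "2 * \<alpha> * (r / 2)\<^sup>2 = real CARD('n) + 1 / 2"
      using r by (simp add: \<alpha>_def power_divide field_simps)
    ultimately show ?thesis
      using uw0 \<alpha> by (intro mult_pos_pos) (auto simp: \<epsilon>_def E_def)
  qed
  ultimately show False using super[of z] by linarith
qed

section \<open>The gradient of a power of a positive function\<close>

lemma norm_gradient_powr:
  assumes u: "u differentiable (at x)" "u x > 0"
  shows "norm (gradient (\<lambda>y. u y powr a) x) = \<bar>a\<bar> * u x powr (a - 1) * norm (gradient u x)"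
proof -
  have "((\<lambda>t. t powr a) has_real_derivative a * u x powr (a - 1)) (at (u x))"
    using u(2) by (rule has_real_derivative_powr)
  moreover have "(u has_derivative frechet_derivative u (at x)) (at x)"
    using u(1) by (simp add: frechet_derivative_works)
  ultimately have "((\<lambda>y. u y powr a) has_derivative
      (\<lambda>h. frechet_derivative u (at x) h * (a * u x powr (a - 1)))) (at x)"
    by (rule DERIV_compose_FDERIV)
  then have "frechet_derivative (\<lambda>y. u y powr a) (at x)
      = (\<lambda>h. frechet_derivative u (at x) h * (a * u x powr (a - 1)))"
    using frechet_derivative_at by metis
  then have "gradient (\<lambda>y. u y powr a) x = (a * u x powr (a - 1)) *\<^sub>R gradient u x"
    unfolding gradient_def partial_derivative_def by (simp add: vec_eq_iff mult.commute)
  then show ?thesis by (simp add: abs_mult)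
qed

subsection \<open>The gradient estimate\<close>

theorem theoremD:
  fixes p q :: real
  assumes "CARD('n::finite) \<ge> 2"
    and "1 < p" and "p < (real CARD('n) + 3) / (real CARD('n) - 1)"
    and "1 < q" and "q < (real CARD('n) + 2) / real CARD('n)"
  shows "(\<exists>a>0. \<exists>c>0. \<forall>\<Omega> :: (real^'n) set. is_domain \<Omega> \<and> frontier \<Omega> \<noteq> {} \<longrightarrow>
            (\<forall>M>0. \<forall>u. is_solution p q M \<Omega> u \<and> (\<forall>x\<in>\<Omega>. u x > 0) \<longrightarrow>
               (\<forall>x\<in>\<Omega>. norm (gradient (\<lambda>y. u y powr a) x)
                  \<le> c * infdist x (frontier \<Omega>) powr (- (2 * a / (p - 1)) - 1)))) \<and>
         (\<forall>M>0. \<not> (\<exists>u :: real^'n \<Rightarrow> real. is_solution p q M UNIV u \<and>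
            (\<forall>x. u x \<ge> 0) \<and> (\<exists>x. u x \<noteq> 0)))"
proof -
  obtain \<sigma> C where \<sigma>: "\<sigma> > 0" and C: "C > 0" and bound: "\<And>S (u :: real^'n \<Rightarrow> real) M x0 R.
    open S \<Longrightarrow> cball x0 R \<subseteq> S \<Longrightarrow> 0 < R \<Longrightarrow> 0 \<le> M \<Longrightarrow> is_solution p q M S u \<Longrightarrow> \<forall>x\<in>S. u x > 0 \<Longrightarrow>
    (norm (gradient u x0))\<^sup>2 / (u x0)\<^sup>2 * u x0 powr \<sigma> \<le> C * R powr (- (2 + 2 * \<sigma> / (p - 1)))"
    using gradient_bound_ball[OF assms] by blast
  \<comment> \<open>The squared norm of the gradient of \<open>u powr a\<close> is
    \<open>a\<^sup>2\<close> times \<open>(norm (gradient u x))\<^sup>2 / (u x)\<^sup>2 * u x powr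
    (2 * a)\<close>, so the local bound fits when \<open>2 * a = \<sigma>\<close>.\<close>
  define a where "a = \<sigma> / 2"
  define b where "b = - (2 * a / (p - 1)) - 1"
  \<comment> \<open>The factor \<open>(1 / 2) powr b\<close> arises because the local bound is used
    on the ball of half the distance to the frontier.\<close>
  define c where "c = a * (sqrt C * (1 / 2) powr b)"
  have a: "a > 0" "c > 0" using \<sigma> C by (auto simp: a_def c_def)
  have estimate: "norm (gradient (\<lambda>y. u y powr a) x) \<le> c * infdist x (frontier \<Omega>) powr b"
    if \<Omega>: "is_domain \<Omega>" "frontier \<Omega> \<noteq> {}" and M: "M > 0"
      and u: "is_solution p q M \<Omega> u" "\<forall>x\<in>\<Omega>. u x > 0" and x: "x \<in> \<Omega>"
    for \<Omega> M x and u :: "real^'n \<Rightarrow> real"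
  proof -
    have op: "open \<Omega>" using \<Omega> by (simp add: is_domain_def)
    define d where "d = infdist x (frontier \<Omega>)"
    have "x \<notin> frontier \<Omega>" using x op by (simp add: frontier_def interior_open)
    then have d: "d > 0"
      using \<Omega>(2) unfolding d_def by (intro infdist_pos_not_in_closed) auto
    \<comment> \<open>A ball meeting both the domain and its complement would, being connected,
      contain a frontier point at distance at most \<open>d / 2\<close>.\<close>
    have "cball x (d / 2) \<subseteq> \<Omega>"
    proof (rule ccontr)
      assume "\<not> cball x (d / 2) \<subseteq> \<Omega>"
      then have "cball x (d / 2) - \<Omega> \<noteq> {}" by blast
      moreover have "cball x (d / 2) \<inter> \<Omega> \<noteq> {}" using x d centre_in_cball[of x "d / 2"] by fastforce
      ultimately have "cball x (d / 2) \<inter> frontier \<Omega> \<noteq> {}"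
        using connected_Int_frontier[of "cball x (d / 2)" \<Omega>] by (simp add: convex_connected)
      then obtain w where "w \<in> frontier \<Omega>" "dist x w \<le> d / 2" by auto
      then show False using infdist_le[of w "frontier \<Omega>" x] d by (simp add: d_def)
    qed
    moreover have "- (2 + 2 * \<sigma> / (p - 1)) = b + b" by (simp add: b_def a_def)
    ultimately have bd: "(norm (gradient u x))\<^sup>2 / (u x)\<^sup>2 * u x powr \<sigma> \<le> C * (d / 2) powr (b + b)"
      using bound[OF op _ _ _ u, of x "d / 2"] d M by simp
    have ux: "u x > 0" using u x by simp
    have diff: "u differentiable (at x)"
      using u(1) x op by (auto simp: is_solution_def C2_on_def C1_on_def differentiable_on_eq_differentiable_at)
    have "(u x powr (a - 1) * norm (gradient u x))\<^sup>2
        = (norm (gradient u x))\<^sup>2 * ((u x powr (a - 1)) * (u x powr (a - 1)))"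
      by (simp add: power2_eq_square)
    also have "(u x powr (a - 1)) * (u x powr (a - 1)) = u x powr \<sigma> / (u x)\<^sup>2"
      using ux by (simp add: powr_add[symmetric] a_def powr_diff power2_eq_square)
    finally have "(u x powr (a - 1) * norm (gradient u x))\<^sup>2 \<le> C * (d / 2) powr (b + b)"
      using bd by simp
    also have "\<dots> = (sqrt C * (d / 2) powr b)\<^sup>2"
      using C unfolding powr_add by (simp add: power_mult_distrib power2_eq_square[of "_ powr _"])
    finally have "u x powr (a - 1) * norm (gradient u x) \<le> sqrt C * (d / 2) powr b"
      by (rule power2_le_imp_le) (use C in simp)
    then have "a * (u x powr (a - 1) * norm (gradient u x)) \<le> a * (sqrt C * (d / 2) powr b)"
      using a by (intro mult_left_mono) simp_all
    moreover have "norm (gradient (\<lambda>y. u y powr a) x) = a * (u x powr (a - 1) * norm (gradient u x))"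
      using norm_gradient_powr[OF diff ux, of a] a by simp
    moreover have "(d / 2) powr b = (1 / 2) powr b * d powr b"
      using powr_mult[of "1 / 2" d b] d by simp
    ultimately show ?thesis
      unfolding c_def d_def[symmetric] by (simp only: mult.assoc)
  qed
  have liouville: False
    if M: "M > 0" and u: "is_solution p q M UNIV u" "\<forall>x. u x \<ge> 0" "u x1 \<noteq> 0"
    for M x1 and u :: "real^'n \<Rightarrow> real"
  proof -
    have eq: "- laplacian u x = \<bar>u x\<bar> powr (p - 1) * u x + M * norm (gradient u x) powr q" for x
      using u(1) by (simp add: is_solution_def)
    have "laplacian u x \<le> 0" for x
    proof -
      have "0 \<le> \<bar>u x\<bar> powr (p - 1) * u x" "0 \<le> M * norm (gradient u x) powr q"
        using u(2) M by auto
      then show ?thesis using eq[of x] by linarith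
    qed
    then have pos: "u x > 0" for x
      using superharmonic_positive[of u x1 x] u by (auto simp: is_solution_def)
    have "gradient u x = 0" for x
    proof -
      let ?G = "(norm (gradient u x))\<^sup>2 / (u x)\<^sup>2 * u x powr \<sigma>"
      let ?m = "2 + 2 * \<sigma> / (p - 1)"
      have "?m > 0" using \<sigma> assms(2) by (simp add: add_pos_pos)
      \<comment> \<open>In the whole space every radius is admissible with the same constant, so
        letting \<open>R\<close> tend to infinity annihilates the gradient at each fixed
        point.\<close>
      then have "((\<lambda>R. C * R powr (- ?m)) \<longlongrightarrow> C * 0) at_top"
        by (intro tendsto_mult tendsto_const tendsto_neg_powr filterlim_ident) simp
      moreover have "\<forall>\<^sub>F R in at_top. ?G \<le> C * R powr (- ?m)"
        by (rule eventually_mono[OF eventually_gt_at_top[of 0]], rule bound[of UNIV])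
          (use M u(1) pos in simp_all)
      ultimately have "?G \<le> C * 0"
        by (rule tendsto_lowerbound) simp
      then show ?thesis using pos[of x] by (simp add: mult_le_0_iff divide_le_0_iff)
    qed
    \<comment> \<open>All first derivatives vanish identically, hence so does the Laplacian, while
      the right-hand side of the equation is positive because \<open>u\<close> is.\<close>
    then have "partial_derivative i u = (\<lambda>x. 0)" for i
      by (auto simp: gradient_def vec_eq_iff fun_eq_iff)
    then have "laplacian u x1 = 0"
      by (simp add: laplacian_def partial_derivative_def[of _ "\<lambda>x. 0"])
    moreover have "\<bar>u x1\<bar> powr (p - 1) * u x1 > 0" using pos[of x1] by simp
    moreover have "M * norm (gradient u x1) powr q \<ge> 0" using M by simp
    ultimately show False using eq[of x1] by linarith
  qed
  show ?thesis
    using a estimate liouville unfolding b_def by blast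
qed

end
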